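(* For every $r\in\mathbb{N}$ there exist constants $c_{r,1},c_{r,2}>0$ (depending only on $r$) such that for all $d\in\mathbb{N}$ and all $\varepsilon\in(0,1/2)$, $$ c_{r,1}^d\left(\frac{d}{\varepsilon}\right)^{d/r}\;\le\; n(\varepsilon,d,r)\;\le\; c_{r,2}^d\left(\frac{d}{\varepsilon}\right)^{d/r}. $$ Moreover, the lower bound also holds when the integration problem is considered over an arbitrary open set of volume one instead of the unit cube, i.e., $n(\varepsilon,D_d,r)\ge c_{r,1}^d (d/\varepsilon)^{d/r}$ for every open set $D_d\subset\mathbb{R}^d$ with $d$-dimensional volume $1$, all $d\in\mathbb{N}$ and all $\varepsilon\in(0,1/2)$; and the upper bound $n(\varepsilon,d,r)\le c_{r,2}^d(d/\varepsilon)^{d/r}$ holds for all $\varepsilon\in(0,1)$.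
   Context: Here $\mathbb{N}=\{1,2,\dots\}$, $\mathbb{N}_0=\{0,1,2,\dots\}$, and $|\beta|_1=\beta_1+\dots+\beta_d$ for $\beta\in\mathbb{N}_0^d$; $D^\beta$ is the partial derivative of order $\beta$. Let $D$ be either $[0,1]^d$ or an open subset of $\mathbb{R}^d$ with volume $1$. Let $\mathcal{C}^r(D)$ be the class of all $r$-times continuously differentiable functions $f:D\to\mathbb{R}$ with $\sup_{x\in D}|(D^\beta f)(x)|\le 1$ for all $\beta\in\mathbb{N}_0^d$ with $|\beta|_1\le r$. The problem is to approximate $S(f)=\int_{D} f(x)\,dx$ for $f\in\mathcal{C}^r(D)$. An algorithm using $n$ function values is a map $A_n:\mathcal{C}^r(D)\to\mathbb{R}$ of the form $A_n(f)=\phi_n(f(x_1),\dots,f(x_n))$, where $\phi_n:\mathbb{R}^n\to\mathbb{R}$ is an arbitrary (possibly nonlinear) map and the sample points $x_i\in D$ may be chosen adaptively, i.e., $x_i$ may depend on the already computed values $f(x_1),\dots,f(x_{i-1})$ (for $n=0$, $A_0$ is a constant). Its worst case error is $e(A_n)=\sup_{f\in\mathcal{C}^r(D)}|S(f)-A_n(f)|$, and the $n$th minimal error is $e_n(\mathcal{C}^r(D))=\inf_{A_n}e(A_n)$, the infimum being over all such algorithms. Define $$n(\varepsilon,D,r)=\min\{n\in\mathbb{N}_0:\ e_n(\mathcal{C}^r(D))\le\varepsilon\},\qquad n(\varepsilon,d,r)=n(\varepsilon,[0,1]^d,r).$$ *)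

theory Defs
  imports "HOL-Analysis.Analysis"
begin

text \<open>
  The dimension \<open>d\<close> is quantified after the constants, so it cannot be a type. A point of
  \<open>\<real>\<^sup>d\<close> is an element of \<open>{..<d} \<rightarrow>\<^sub>E UNIV\<close>, a function that is \<open>undefined\<close> outside \<open>{..<d}\<close>;
  this is the carrier both of the product topology and of the product measure over \<open>{..<d}\<close>.
  A function \<open>D \<rightarrow> \<real>\<close> is a total function whose values outside \<open>D\<close> are never used.
\<close>

type_synonym point = "nat \<Rightarrow> real"

definition rn_topology :: "nat \<Rightarrow> point topology" where
  "rn_topology d = product_topology (\<lambda>_. euclideanreal) {..<d}"

definition rn_lborel :: "nat \<Rightarrow> point measure" where
  "rn_lborel d = (\<Pi>\<^sub>M i\<in>{..<d}. lborel)"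

definition unit_cube :: "nat \<Rightarrow> point set" where
  "unit_cube d = ({..<d} \<rightarrow>\<^sub>E {0..1})"

text \<open>
  The partial derivative is taken within the section of \<open>D\<close> through \<open>x\<close> in direction \<open>i\<close>:
  for open \<open>D\<close> it is the ordinary one, on the faces of the cube it is one-sided.
\<close>

definition line_section :: "point set \<Rightarrow> nat \<Rightarrow> point \<Rightarrow> real set" where
  "line_section D i x = {t. x(i := t) \<in> D}"

definition has_partial :: "point set \<Rightarrow> nat \<Rightarrow> (point \<Rightarrow> real) \<Rightarrow> point \<Rightarrow> bool" where
  "has_partial D i f x \<longleftrightarrow>
     (\<lambda>t. f (x(i := t))) differentiable (at (x i) within line_section D i x)"

definition partial :: "point set \<Rightarrow> nat \<Rightarrow> (point \<Rightarrow> real) \<Rightarrow> point \<Rightarrow> real" where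
  "partial D i f x =
     vector_derivative (\<lambda>t. f (x(i := t))) (at (x i) within line_section D i x)"

fun cont_diff :: "nat \<Rightarrow> point set \<Rightarrow> nat \<Rightarrow> (point \<Rightarrow> real) \<Rightarrow> bool" where
  "cont_diff d D 0 f \<longleftrightarrow> continuous_map (subtopology (rn_topology d) D) euclideanreal f"
| "cont_diff d D (Suc k) f \<longleftrightarrow>
     continuous_map (subtopology (rn_topology d) D) euclideanreal f \<and>
     (\<forall>i<d. (\<forall>x\<in>D. has_partial D i f x) \<and> cont_diff d D k (partial D i f))"

text \<open>
  \<open>multi_partial D \<beta> d f\<close> is \<open>D\<^sup>\<beta> f\<close> for the multi-index \<open>(\<beta> 0, \<dots>, \<beta> (d - 1))\<close>. The order of
  differentiation is immaterial on the class of continuously differentiable functions below.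
\<close>

fun multi_partial ::
    "point set \<Rightarrow> (nat \<Rightarrow> nat) \<Rightarrow> nat \<Rightarrow> (point \<Rightarrow> real) \<Rightarrow> point \<Rightarrow> real" where
  "multi_partial D \<beta> 0 f = f"
| "multi_partial D \<beta> (Suc j) f = (partial D j ^^ \<beta> j) (multi_partial D \<beta> j f)"

definition C_class :: "nat \<Rightarrow> point set \<Rightarrow> nat \<Rightarrow> (point \<Rightarrow> real) set" where
  "C_class d D r = {f. cont_diff d D r f \<and>
     (\<forall>\<beta>. (\<Sum>i<d. \<beta> i) \<le> r \<longrightarrow> (SUP x\<in>D. ereal \<bar>multi_partial D \<beta> d f x\<bar>) \<le> 1)}"

definition integral_on :: "nat \<Rightarrow> point set \<Rightarrow> (point \<Rightarrow> real) \<Rightarrow> real" where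
  "integral_on d D f = (LINT x:D|rn_lborel d. f x)"

text \<open>
  Adaptive information: \<open>\<psi>\<close> maps the list of values computed so far to the next sample point,
  in particular \<open>\<psi> []\<close> is the first one.
\<close>

fun info :: "(real list \<Rightarrow> point) \<Rightarrow> nat \<Rightarrow> (point \<Rightarrow> real) \<Rightarrow> real list" where
  "info \<psi> 0 f = []"
| "info \<psi> (Suc n) f = info \<psi> n f @ [f (\<psi> (info \<psi> n f))]"

definition algorithms :: "point set \<Rightarrow> nat \<Rightarrow> ((point \<Rightarrow> real) \<Rightarrow> real) set" where
  "algorithms D n = {A. \<exists>\<psi> \<phi>. (\<forall>ys. \<psi> ys \<in> D) \<and> A = (\<lambda>f. \<phi> (info \<psi> n f))}"

definition worst_case_error ::
    "nat \<Rightarrow> point set \<Rightarrow> nat \<Rightarrow> ((point \<Rightarrow> real) \<Rightarrow> real) \<Rightarrow> ereal" where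
  "worst_case_error d D r A = (SUP f\<in>C_class d D r. ereal \<bar>integral_on d D f - A f\<bar>)"

definition minimal_error :: "nat \<Rightarrow> point set \<Rightarrow> nat \<Rightarrow> nat \<Rightarrow> ereal" where
  "minimal_error d D r n = (INF A\<in>algorithms D n. worst_case_error d D r A)"

text \<open>The minimum is taken in the extended naturals, so it is \<open>\<infinity>\<close> if no \<open>n\<close> qualifies.\<close>

definition info_complexity :: "real \<Rightarrow> nat \<Rightarrow> point set \<Rightarrow> nat \<Rightarrow> enat" where
  "info_complexity \<epsilon> d D r = (INF n\<in>{n. minimal_error d D r n \<le> ereal \<epsilon>}. enat n)"

end

theory Submission
  imports Defs "HOL-Probability.Probability"
begin

text \<open>
  Both bounds compare the dimension with the length scale \<open>\<delta> = (\<epsilon> / d) powr (1 / r)\<close>: about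
  \<open>\<delta>\<close> to the power \<open>- d\<close> samples are necessary and sufficient, up to a factor that is exponential
  in \<open>d\<close>.

  Lower bound. Run the algorithm on the zero function; it samples at \<open>n\<close> points \<open>p\<close>. Take the
  \<open>\<ell>\<^sup>1\<close>-distance to these points, reduced by \<open>r d \<delta>\<close> and truncated to the interval from \<open>0\<close> to
  \<open>d \<delta>\<close>. Changing one coordinate changes it at most as fast as that coordinate. Average it
  \<open>r\<close> times over a window of length \<open>2 \<delta>\<close> in every coordinate. The partial derivative of an
  average is a central difference quotient, and averages and difference quotients commute, so a
  derivative of order \<open>k\<close> of the result is an average of \<open>k\<close> difference quotients of the truncated
  distance. The first quotient is at most \<open>1\<close> by the Lipschitz property and each further one costs a
  factor \<open>1 / \<delta>\<close>. Multiplied by \<open>\<delta>\<close> to the power \<open>r - 1\<close>, the function is therefore in the class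
  (\<open>smoothed_in_C_class\<close>) and has height \<open>d \<delta>\<^sup>r\<close>; it vanishes at all sample points, because the
  averages move a point by at most \<open>r d \<delta>\<close> in \<open>\<ell>\<^sup>1\<close>, and it attains its full height outside the
  \<open>\<ell>\<^sup>1\<close>-balls of radius \<open>(2 r + 1) d \<delta>\<close> (\<open>fooling_function\<close>). Such a ball has volume at most
  \<open>(2 e (2 r + 1) \<delta>)\<^sup>d\<close> (\<open>emeasure_l1_ball_le\<close>), so for small \<open>n\<close> the balls miss more than half of
  the domain. The algorithm cannot distinguish the function from its negative, and with
  \<open>d \<delta>\<^sup>r = 2 \<epsilon>\<close> one of the two errors exceeds \<open>\<epsilon>\<close> (\<open>info_complexity_lower\<close>). The \<open>\<ell>\<^sup>1\<close> geometry is
  what matters: balls of radius \<open>d \<delta>\<close> are larger than a cube of side \<open>\<delta>\<close> only by a factor exponential in \<open>d\<close>,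
  yet at this radius the distance has reached height \<open>d \<delta>\<close> with all partial slopes at most one.

  Upper bound. In one variable there is a quadrature rule with nonnegative weights that is exact for
  polynomials of degree less than \<open>r\<close> (\<open>positive_quadrature_exists\<close>). Repeated on \<open>m\<close> cells it has
  error at most \<open>2 / m\<^sup>r\<close> if the derivative of order \<open>r\<close> is bounded by one, and it is a probability measure with \<open>O(m)\<close> atoms
  (\<open>composite_quadrature_exists\<close>). Its \<open>d\<close>-fold product replaces the uniform distribution one
  coordinate at a time, and because all measures involved have mass one, each replacement costs
  only the one-dimensional error (\<open>hybrid_product_integral\<close>). The total error is at most
  \<open>2 d / m\<^sup>r\<close> with \<open>O(m)\<^sup>d\<close> samples. Signed weights would multiply the error by a power of their
  total variation.
\<close>

section \<open>Averages and difference quotients in one coordinate\<close>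

definition avg :: "real \<Rightarrow> nat \<Rightarrow> (point \<Rightarrow> real) \<Rightarrow> point \<Rightarrow> real" where
  "avg \<delta> i u x = integral {-\<delta>..\<delta>} (\<lambda>t. u (x(i := x i + t))) / (2 * \<delta>)"

definition diffq :: "real \<Rightarrow> nat \<Rightarrow> (point \<Rightarrow> real) \<Rightarrow> point \<Rightarrow> real" where
  "diffq \<delta> i u x = (u (x(i := x i + \<delta>)) - u (x(i := x i - \<delta>))) / (2 * \<delta>)"

text \<open>The smoothed functions are defined on all functions from \<open>nat\<close> to \<open>real\<close>, with the product
topology, where continuity is a plain \<open>continuous_on UNIV\<close>; the points of \<open>rn_topology d\<close> are
included continuously. The word \<open>w\<close> records which averages were applied; its order is immaterial
on continuous functions.\<close>

definition avgs :: "real \<Rightarrow> nat list \<Rightarrow> (point \<Rightarrow> real) \<Rightarrow> point \<Rightarrow> real" where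
  "avgs \<delta> w u = foldr (avg \<delta>) w u"

lemma avgs_Nil [simp]: "avgs \<delta> [] u = u"
  and avgs_Cons [simp]: "avgs \<delta> (i # w) u = avg \<delta> i (avgs \<delta> w u)"
  by (simp_all add: avgs_def)

lemma continuous_on_fun_upd:
  fixes g :: "'a::topological_space \<Rightarrow> nat \<Rightarrow> real"
  assumes "continuous_on S g" "continuous_on S h"
  shows "continuous_on S (\<lambda>p. (g p)(i := h p))"
proof (rule continuous_on_coordinatewise_then_product)
  fix j
  show "continuous_on S (\<lambda>p. ((g p)(i := h p)) j)"
    using assms continuous_on_product_then_coordinatewise[OF assms(1), of j]
    by (cases "j = i") auto
qed

lemma continuous_on_coord: "continuous_on S (\<lambda>p :: point. p i)"
  by (rule continuous_on_subset[OF continuous_on_product_coordinates]) simp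

lemma continuous_on_fst_coord: "continuous_on S (\<lambda>p :: point \<times> 'a::topological_space. fst p i)"
  by (rule continuous_on_product_then_coordinatewise[OF continuous_on_fst[OF continuous_on_id]])

lemma continuous_on_compose_UNIV:
  assumes "continuous_on UNIV u" "continuous_on S g"
  shows "continuous_on S (\<lambda>p. u (g p))"
  using continuous_on_compose2[OF assms] by simp

lemma continuous_on_section:
  fixes u :: "point \<Rightarrow> real"
  assumes "continuous_on UNIV u" "continuous_on S h"
  shows "continuous_on S (\<lambda>t. u (x(i := h t)))"
  by (intro continuous_on_compose_UNIV[OF assms(1)] continuous_on_fun_upd assms continuous_on_const)

lemma integrable_section:
  fixes u :: "point \<Rightarrow> real" and a b :: real
  assumes "continuous_on UNIV u" "continuous_on {a..b} h"
  shows "(\<lambda>t. u (x(i := h t))) integrable_on {a..b}"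
  by (rule integrable_continuous_real[OF continuous_on_section[OF assms]])

lemma continuous_on_avg:
  assumes u: "continuous_on UNIV u"
  shows "continuous_on UNIV (avg \<delta> i u)"
proof -
  have "continuous_on UNIV (\<lambda>x. integral (cbox (-\<delta>) \<delta>) (\<lambda>t. u (x(i := x i + t))))"
  proof (rule integral_continuous_on_param)
    have "continuous_on (UNIV \<times> cbox (- \<delta>) \<delta>) (\<lambda>p. u ((fst p)(i := fst p i + snd p)))"
      by (intro continuous_on_compose_UNIV[OF u] continuous_on_fun_upd continuous_on_coord continuous_on_fst_coord continuous_intros)
    then show "continuous_on (UNIV \<times> cbox (- \<delta>) \<delta>) (\<lambda>(x, t). u (x(i := x i + t)))"
      by (simp add: case_prod_unfold)
  qed
  then have "continuous_on UNIV (\<lambda>x. integral {-\<delta>..\<delta>} (\<lambda>t. u (x(i := x i + t))) * inverse (2 * \<delta>))"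
    by (intro continuous_intros) simp
  then show ?thesis
    unfolding avg_def[abs_def] divide_inverse .
qed

lemma continuous_on_avgs:
  "continuous_on UNIV u \<Longrightarrow> continuous_on UNIV (avgs \<delta> w u)"
  by (induction w) (auto intro: continuous_on_avg)

lemma continuous_on_diffq:
  assumes u: "continuous_on UNIV u"
  shows "continuous_on UNIV (diffq \<delta> i u)"
proof -
  have "continuous_on UNIV (\<lambda>x. (u (x(i := x i + \<delta>)) - u (x(i := x i - \<delta>))) * inverse (2 * \<delta>))"
    by (intro continuous_on_compose_UNIV[OF u] continuous_on_fun_upd continuous_on_coord continuous_on_fst_coord continuous_intros)
  then show ?thesis
    unfolding diffq_def[abs_def] divide_inverse .
qed

text \<open>Fubini on a square, for continuous integrands.\<close>

lemma avg_commute: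
  assumes u: "continuous_on UNIV u"
  shows "avg \<delta> i (avg \<delta> j u) = avg \<delta> j (avg \<delta> i u)"
proof (cases "i = j")
  case False
  show ?thesis
  proof
    fix x
    define F where "F s t = u (x(i := x i + s, j := x j + t))" for s t
    have F: "continuous_on (cbox (-\<delta>, -\<delta>) (\<delta>, \<delta>)) (\<lambda>(s, t). F s t)"
    proof -
      have "continuous_on (cbox (-\<delta>, -\<delta>) (\<delta>, \<delta>)) (\<lambda>p. u (x(i := x i + fst p, j := x j + snd p)))"
        by (intro continuous_on_compose_UNIV[OF u] continuous_on_fun_upd continuous_on_coord continuous_on_fst_coord continuous_intros)
      then show ?thesis
        by (simp add: case_prod_unfold F_def)
    qed
    have "integral {-\<delta>..\<delta>} (\<lambda>s. integral {-\<delta>..\<delta>} (F s)) =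
          integral {-\<delta>..\<delta>} (\<lambda>t. integral {-\<delta>..\<delta>} (\<lambda>s. F s t))"
      using integral_swap_continuous[OF F] by simp
    then show "avg \<delta> i (avg \<delta> j u) x = avg \<delta> j (avg \<delta> i u) x"
      using False unfolding avg_def F_def[abs_def] by (simp add: fun_upd_twist)
  qed
qed simp

text \<open>Any average that occurs in the word can be performed last. This puts a function into the form in
which it can be differentiated in a given direction.\<close>

lemma avgs_remove1:
  assumes u: "continuous_on UNIV u" and "i \<in> set w"
  shows "avgs \<delta> w u = avg \<delta> i (avgs \<delta> (remove1 i w) u)"
  using assms(2)
proof (induction w)
  case (Cons j w)
  show ?case
  proof (cases "j = i")
    case False
    then have "avgs \<delta> w u = avg \<delta> i (avgs \<delta> (remove1 i w) u)"
      using Cons by auto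
    then show ?thesis
      using False avg_commute[OF continuous_on_avgs[OF u]] by simp
  qed simp
qed simp

lemma avg_diffq:
  assumes u: "continuous_on UNIV u"
  shows "avg \<delta> i (diffq \<delta> j u) = diffq \<delta> j (avg \<delta> i u)"
proof
  fix x
  have int: "(\<lambda>t. u (y(k := c + t))) integrable_on {-\<delta>..\<delta>}" for y k c
    by (rule integrable_section[OF u]) (intro continuous_intros)
  show "avg \<delta> i (diffq \<delta> j u) x = diffq \<delta> j (avg \<delta> i u) x"
  proof (cases "i = j")
    case True
    have *: "integral {-\<delta>..\<delta>} (\<lambda>t. (u (x(j := x j + t + \<delta>)) - u (x(j := x j + t - \<delta>))) / (2*\<delta>)) =
        (integral {-\<delta>..\<delta>} (\<lambda>t. u (x(j := (x j + \<delta>) + t))) - integral {-\<delta>..\<delta>} (\<lambda>t. u (x(j := (x j - \<delta>) + t)))) / (2*\<delta>)"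
      unfolding integral_diff[OF int int, symmetric] integral_divide[symmetric]
      by (rule integral_cong) (simp only: add_diff_eq diff_add_eq add.assoc add.commute[of \<delta>])
    show ?thesis
      unfolding avg_def diffq_def using True * by (simp add: diff_divide_distrib)
  next
    case False
    have *: "integral {-\<delta>..\<delta>} (\<lambda>t. (u (x(i := x i + t, j := x j + \<delta>)) - u (x(i := x i + t, j := x j - \<delta>))) / (2*\<delta>)) =
        (integral {-\<delta>..\<delta>} (\<lambda>t. u (x(j := x j + \<delta>, i := x i + t))) - integral {-\<delta>..\<delta>} (\<lambda>t. u (x(j := x j - \<delta>, i := x i + t)))) / (2*\<delta>)"
      unfolding integral_diff[OF int int, symmetric] integral_divide[symmetric] fun_upd_twist[OF False] ..
    show ?thesis
      unfolding avg_def diffq_def using False * by (simp add: diff_divide_distrib)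
  qed
qed

text \<open>Difference quotients pass through all averages down to the rough function, where they can be
estimated.\<close>

lemma avgs_diffq:
  assumes u: "continuous_on UNIV u"
  shows "avgs \<delta> w (diffq \<delta> i u) = diffq \<delta> i (avgs \<delta> w u)"
  by (induction w) (simp_all add: avg_diffq continuous_on_avgs u)

text \<open>The fundamental theorem of calculus for a moving window. An antiderivative is needed only on a
neighbourhood of the window, here of twice its half length.\<close>

lemma has_derivative_window_integral:
  fixes v :: "real \<Rightarrow> real"
  assumes v: "continuous_on UNIV v" and "\<delta> > 0"
  shows "((\<lambda>s. integral {-\<delta>..\<delta>} (\<lambda>t. v (s + t))) has_real_derivative v (s + \<delta>) - v (s - \<delta>)) (at s)"
proof -
  obtain G where G: "\<And>x. x \<in> {s - 2*\<delta>..s + 2*\<delta>} \<Longrightarrow>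
      (G has_vector_derivative v x) (at x within {s - 2*\<delta>..s + 2*\<delta>})"
    using antiderivative_continuous[of "s - 2*\<delta>" "s + 2*\<delta>" v] v continuous_on_subset by blast
  have G': "(G has_real_derivative v x) (at x)" if "x \<in> {s - 2*\<delta><..<s + 2*\<delta>}" for x
  proof -
    have "at x within {s - 2*\<delta>..s + 2*\<delta>} = at x"
      using that by (intro at_within_interior) auto
    then show ?thesis
      using G[of x] that by (simp add: has_real_derivative_iff_has_vector_derivative)
  qed
  have eq: "integral {-\<delta>..\<delta>} (\<lambda>t. v (a + t)) = G (a + \<delta>) - G (a - \<delta>)"
    if "\<bar>a - s\<bar> < \<delta>" for a
  proof -
    have "((\<lambda>t. v (a + t)) has_integral G (a + \<delta>) - G (a + - \<delta>)) {-\<delta>..\<delta>}"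
    proof (rule fundamental_theorem_of_calculus)
      show "-\<delta> \<le> \<delta>" using \<open>\<delta> > 0\<close> by simp
      fix t assume "t \<in> {-\<delta>..\<delta>}"
      then have "(G has_real_derivative v (a + t)) (at (a + t))"
        using that by (intro G') auto
      then have "((\<lambda>t. G (a + t)) has_real_derivative v (a + t)) (at t)"
        using DERIV_at_within_shift[of G "v (a + t)" a t UNIV] by simp
      then show "((\<lambda>t. G (a + t)) has_vector_derivative v (a + t)) (at t within {-\<delta>..\<delta>})"
        using has_real_derivative_iff_has_vector_derivative has_vector_derivative_at_within by blast
    qed
    then show ?thesis by (simp add: integral_unique)
  qed
  have der: "((\<lambda>a. G (a + \<delta>) - G (a - \<delta>)) has_real_derivative v (s + \<delta>) - v (s - \<delta>)) (at s)"
  proof (rule DERIV_diff)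
    show "((\<lambda>a. G (a + \<delta>)) has_real_derivative v (s + \<delta>)) (at s)"
      using G'[of "s + \<delta>"] \<open>\<delta> > 0\<close> by (subst DERIV_shift[symmetric]) auto
    show "((\<lambda>a. G (a - \<delta>)) has_real_derivative v (s - \<delta>)) (at s)"
      using G'[of "s - \<delta>"] \<open>\<delta> > 0\<close> DERIV_shift[of G "v (s - \<delta>)" s "-\<delta>", THEN iffD1] by simp
  qed
  have "\<forall>\<^sub>F a in nhds s. G (a + \<delta>) - G (a - \<delta>) = integral {-\<delta>..\<delta>} (\<lambda>t. v (a + t))"
    unfolding eventually_nhds_metric using eq \<open>\<delta> > 0\<close> by (intro exI[of _ \<delta>]) (simp add: dist_real_def)
  from DERIV_cong_ev[OF refl this refl] der show ?thesis
    by blast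
qed

lemma has_derivative_avg:
  assumes u: "continuous_on UNIV u" and "\<delta> > 0"
  shows "((\<lambda>t. avg \<delta> i u (x(i := t))) has_real_derivative diffq \<delta> i u x) (at (x i))"
proof -
  have "continuous_on UNIV (\<lambda>t. u (x(i := t)))"
    by (rule continuous_on_section[OF u]) (intro continuous_intros)
  from DERIV_cdivide[OF has_derivative_window_integral[OF this \<open>\<delta> > 0\<close>, of "x i"], of "2*\<delta>"]
  show ?thesis
    by (simp add: avg_def diffq_def)
qed

lemma avg_bound:
  assumes u: "continuous_on UNIV u" and "\<delta> > 0" and "\<And>x. a \<le> u x" "\<And>x. u x \<le> b"
  shows "a \<le> avg \<delta> i u x" "avg \<delta> i u x \<le> b"
proof -
  have int: "(\<lambda>t. u (x(i := x i + t))) integrable_on {-\<delta>..\<delta>}"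
    by (rule integrable_section[OF u]) (intro continuous_intros)
  have "integral {-\<delta>..\<delta>} (\<lambda>t. a) \<le> integral {-\<delta>..\<delta>} (\<lambda>t. u (x(i := x i + t)))"
    using assms by (intro integral_le int) auto
  then show "a \<le> avg \<delta> i u x"
    using \<open>\<delta> > 0\<close> by (simp add: avg_def field_simps)
  have "integral {-\<delta>..\<delta>} (\<lambda>t. u (x(i := x i + t))) \<le> integral {-\<delta>..\<delta>} (\<lambda>t. b)"
    using assms by (intro integral_le int) auto
  then show "avg \<delta> i u x \<le> b"
    using \<open>\<delta> > 0\<close> by (simp add: avg_def field_simps)
qed

lemma avgs_bound:
  assumes u: "continuous_on UNIV u" and "\<delta> > 0" and "\<And>x. a \<le> u x" "\<And>x. u x \<le> b"
  shows "a \<le> avgs \<delta> w u x" "avgs \<delta> w u x \<le> b"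
proof -
  have "(\<forall>x. a \<le> avgs \<delta> w u x) \<and> (\<forall>x. avgs \<delta> w u x \<le> b)"
    by (induction w) (use assms in \<open>auto intro!: avg_bound continuous_on_avgs\<close>)
  then show "a \<le> avgs \<delta> w u x" "avgs \<delta> w u x \<le> b" by auto
qed

text \<open>Only the values of \<open>u\<close> in the box that the averages reach enter: if \<open>u\<close> is constant there, the
average is that constant.\<close>

lemma avgs_local_const:
  assumes "\<delta> > 0"
    and "\<And>y. (\<And>i. \<bar>y i - x i\<bar> \<le> real (count_list w i) * \<delta>) \<Longrightarrow> u y = c"
  shows "avgs \<delta> w u x = c"
  using assms(2)
proof (induction w arbitrary: x)
  case Nil
  then show ?case by simp
next
  case (Cons j w)
  have "avgs \<delta> w u (x(j := x j + t)) = c" if "t \<in> {-\<delta>..\<delta>}" for t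
  proof (rule Cons.IH)
    fix y assume y: "\<And>i. \<bar>y i - (x(j := x j + t)) i\<bar> \<le> real (count_list w i) * \<delta>"
    show "u y = c"
    proof (rule Cons.prems)
      fix i
      show "\<bar>y i - x i\<bar> \<le> real (count_list (j # w) i) * \<delta>"
        using y[of i] that by (cases "i = j") (auto simp: algebra_simps)
    qed
  qed
  then have "integral {-\<delta>..\<delta>} (\<lambda>t. avgs \<delta> w u (x(j := x j + t))) = integral {-\<delta>..\<delta>} (\<lambda>t. c)"
    by (intro integral_cong) auto
  then show ?case
    using \<open>\<delta> > 0\<close> by (simp add: avg_def)
qed

section \<open>Membership of smoothed functions in the class\<close>

text \<open>The bounds that survive \<open>k\<close> difference quotients. For \<open>k = 0\<close> the function is a fooling function
before smoothing, scaled by \<open>\<delta> ^ (r - 1)\<close>. The first quotient is estimated by the Lipschitz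
constant, hence the power \<open>r - 1\<close> at \<open>k = 1\<close>; each later one by the supremum, losing a factor
\<open>1 / \<delta>\<close>. For \<open>k \<le> r\<close> and \<open>\<delta> \<le> 1\<close> all these bounds are at most one.\<close>

definition rough :: "nat \<Rightarrow> nat \<Rightarrow> real \<Rightarrow> nat \<Rightarrow> (point \<Rightarrow> real) \<Rightarrow> bool" where
  "rough d r \<delta> k u \<longleftrightarrow> continuous_on UNIV u \<and>
     (if k = 0
      then (\<forall>x. \<bar>u x\<bar> \<le> 1) \<and>
        (\<forall>i<d. \<forall>x s t. \<bar>u (x(i := s)) - u (x(i := t))\<bar> \<le> \<delta> ^ (r - 1) * \<bar>s - t\<bar>)
      else (\<forall>x. \<bar>u x\<bar> \<le> \<delta> ^ (r - k)))"

lemma rough_diffq: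
  assumes u: "rough d r \<delta> k u" and "i < d" "k < r" "\<delta> > 0"
  shows "rough d r \<delta> (Suc k) (diffq \<delta> i u)"
proof -
  have "\<bar>diffq \<delta> i u x\<bar> \<le> \<delta> ^ (r - Suc k)" for x
  proof (cases "k = 0")
    case True
    then have "\<bar>u (x(i := x i + \<delta>)) - u (x(i := x i - \<delta>))\<bar> \<le> \<delta> ^ (r - 1) * \<bar>(x i + \<delta>) - (x i - \<delta>)\<bar>"
      using u \<open>i < d\<close> by (simp only: rough_def if_True)
    then show ?thesis
      using True \<open>\<delta> > 0\<close> by (simp add: diffq_def pos_divide_le_eq mult.assoc)
  next
    case False
    then have "\<bar>u y\<bar> \<le> \<delta> ^ (r - k)" for y
      using u by (simp add: rough_def)
    from this[of "x(i := x i + \<delta>)"] this[of "x(i := x i - \<delta>)"]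
    have "\<bar>u (x(i := x i + \<delta>)) - u (x(i := x i - \<delta>))\<bar> \<le> 2 * \<delta> ^ (r - k)"
      by linarith
    moreover have "\<delta> ^ (r - k) = \<delta> * \<delta> ^ (r - Suc k)"
      using \<open>k < r\<close> by (metis Suc_diff_Suc power_Suc)
    ultimately show ?thesis
      using \<open>\<delta> > 0\<close> by (simp add: diffq_def pos_divide_le_eq mult_ac)
  qed
  then show ?thesis
    using u by (simp add: rough_def continuous_on_diffq)
qed

lemma rough_le_1:
  assumes "rough d r \<delta> k u" "0 < \<delta>" "\<delta> \<le> 1"
  shows "\<bar>u x\<bar> \<le> 1"
proof (cases "k = 0")
  case False
  then have "\<bar>u x\<bar> \<le> \<delta> ^ (r - k)"
    using assms by (simp add: rough_def)
  also have "\<dots> \<le> 1"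
    using assms by (simp add: power_le_one)
  finally show ?thesis .
qed (use assms in \<open>simp add: rough_def\<close>)

text \<open>Functions that can still be differentiated \<open>m\<close> times in every direction, after \<open>k\<close> derivatives
have been taken.\<close>

definition smoothed :: "nat \<Rightarrow> nat \<Rightarrow> real \<Rightarrow> nat \<Rightarrow> nat \<Rightarrow> (point \<Rightarrow> real) \<Rightarrow> bool" where
  "smoothed d r \<delta> m k h \<longleftrightarrow>
     (\<exists>w u. h = avgs \<delta> w u \<and> rough d r \<delta> k u \<and> (\<forall>i<d. m \<le> count_list w i))"

lemma smoothed_continuous: "smoothed d r \<delta> m k h \<Longrightarrow> continuous_on UNIV h"
  by (auto simp: smoothed_def rough_def continuous_on_avgs)

lemma smoothed_le_1:
  assumes "smoothed d r \<delta> m k h" "0 < \<delta>" "\<delta> \<le> 1"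
  shows "\<bar>h x\<bar> \<le> 1"
proof -
  from assms obtain w u where h: "h = avgs \<delta> w u" and u: "rough d r \<delta> k u"
    by (auto simp: smoothed_def)
  have "- 1 \<le> u y" "u y \<le> 1" for y
    using rough_le_1[OF u assms(2,3), of y] by auto
  then have "- 1 \<le> h x" "h x \<le> 1"
    unfolding h using u assms(2) by (auto intro!: avgs_bound simp: rough_def)
  then show ?thesis by simp
qed

lemma count_list_remove1:
  "count_list (remove1 i w) j = (if i = j then count_list w j - 1 else count_list w j)"
  by (induction w) auto

text \<open>A derivative in direction \<open>i\<close> trades one average in this coordinate for one difference quotient of
the rough function.\<close>

lemma smoothed_derivative:
  assumes h: "smoothed d r \<delta> (Suc m) k h" and "i < d" "k < r" "\<delta> > 0"
  obtains h' where "smoothed d r \<delta> m (Suc k) h'"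
    and "\<And>x. ((\<lambda>t. h (x(i := t))) has_real_derivative h' x) (at (x i))"
proof -
  from h obtain w u where h_eq: "h = avgs \<delta> w u" and u: "rough d r \<delta> k u"
    and w: "\<forall>i<d. Suc m \<le> count_list w i"
    by (auto simp: smoothed_def)
  have cu: "continuous_on UNIV u"
    using u by (simp add: rough_def)
  have "i \<in> set w"
    using w \<open>i < d\<close> by (metis count_notin not_less_eq_eq zero_le)
  then have h2: "h = avg \<delta> i (avgs \<delta> (remove1 i w) u)"
    using avgs_remove1[OF cu] h_eq by simp
  show ?thesis
  proof
    show "smoothed d r \<delta> m (Suc k) (avgs \<delta> (remove1 i w) (diffq \<delta> i u))"
      unfolding smoothed_def
    proof (intro exI conjI)
      show "rough d r \<delta> (Suc k) (diffq \<delta> i u)"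
        by (rule rough_diffq) fact+
      show "\<forall>j<d. m \<le> count_list (remove1 i w) j"
      proof (intro allI impI)
        fix j assume "j < d"
        then have "Suc m \<le> count_list w j" using w by blast
        then show "m \<le> count_list (remove1 i w) j"
          by (auto simp: count_list_remove1)
      qed
    qed simp
    show "((\<lambda>t. h (x(i := t))) has_real_derivative avgs \<delta> (remove1 i w) (diffq \<delta> i u) x) (at (x i))" for x
      unfolding h2 avgs_diffq[OF cu]
      by (rule has_derivative_avg[OF continuous_on_avgs[OF cu] \<open>\<delta> > 0\<close>])
  qed
qed

text \<open>On such a set the derivative within every coordinate section is unique, so \<open>partial\<close> of the
restriction of a smooth function is the restriction of its partial derivative. Open sets and the
cube are both of this kind, which lets one argument serve for both.\<close>

definition accessible :: "nat \<Rightarrow> point set \<Rightarrow> bool" where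
  "accessible d D \<longleftrightarrow> D \<noteq> {} \<and> D \<subseteq> {..<d} \<rightarrow>\<^sub>E UNIV \<and>
     (\<forall>x\<in>D. \<forall>i<d. at (x i) within line_section D i x \<noteq> bot)"

text \<open>Only the values of \<open>f\<close> on \<open>D\<close> are controlled, because an iterated \<open>partial\<close> is meaningless
elsewhere.\<close>

lemma has_partial_within:
  assumes D: "accessible d D" and "i < d" "x \<in> D" and eq: "\<And>y. y \<in> D \<Longrightarrow> f y = h y"
    and der: "((\<lambda>t. h (x(i := t))) has_real_derivative c) (at (x i))"
  shows "has_partial D i f x" "partial D i f x = c"
proof -
  let ?S = "line_section D i x"
  have "((\<lambda>t. h (x(i := t))) has_vector_derivative c) (at (x i) within ?S)"
    using der has_real_derivative_iff_has_vector_derivative has_vector_derivative_at_within by blast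
  \<comment> \<open>Inside the section \<open>f\<close> and \<open>h\<close> agree, and \<open>x i\<close> lies in the section.\<close>
  then have *: "((\<lambda>t. f (x(i := t))) has_vector_derivative c) (at (x i) within ?S)"
    by (rule has_vector_derivative_transform[rotated 2])
       (use eq \<open>x \<in> D\<close> in \<open>auto simp: line_section_def\<close>)
  then show "has_partial D i f x"
    unfolding has_partial_def using differentiableI_vector by blast
  show "partial D i f x = c"
    unfolding partial_def using D \<open>x \<in> D\<close> \<open>i < d\<close>
    by (intro vector_derivative_within *) (auto simp: accessible_def)
qed

lemma continuous_map_rn_topology_id: "continuous_map (rn_topology d) euclidean (\<lambda>x. x)"
proof -
  have "continuous_map (rn_topology d) euclideanreal (\<lambda>x. x k)" for k
  proof (cases "k < d")
    case True
    then show ?thesis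
      unfolding rn_topology_def by (intro continuous_map_product_projection) simp
  next
    case False
    have "continuous_map (rn_topology d) euclideanreal (\<lambda>x. undefined)"
      by simp
    then show ?thesis
      by (rule continuous_map_eq) (use False in \<open>auto simp: rn_topology_def PiE_def extensional_def\<close>)
  qed
  then have "continuous_map (rn_topology d) (product_topology (\<lambda>_. euclideanreal) UNIV) (\<lambda>x. x)"
    unfolding continuous_map_componentwise_UNIV by blast
  then show ?thesis
    by (simp only: euclidean_product_topology)
qed

lemma continuous_map_restrict:
  assumes h: "continuous_on UNIV h" and eq: "\<And>y. y \<in> D \<Longrightarrow> f y = h y"
  shows "continuous_map (subtopology (rn_topology d) D) euclideanreal f"
proof -
  have "continuous_map euclidean euclideanreal h"
    using h by simp
  from continuous_map_compose[OF continuous_map_rn_topology_id this]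
  have "continuous_map (subtopology (rn_topology d) D) euclideanreal h"
    by (simp add: comp_def continuous_map_from_subtopology)
  then show ?thesis
    by (rule continuous_map_eq) (use eq in auto)
qed

lemma cont_diff_smoothed:
  assumes D: "accessible d D" and "\<delta> > 0"
    and "smoothed d r \<delta> m k h" "k + m \<le> r" "\<And>y. y \<in> D \<Longrightarrow> f y = h y"
  shows "cont_diff d D m f"
  using assms(3-)
proof (induction m arbitrary: k h f)
  case 0
  then show ?case
    by (auto intro: continuous_map_restrict smoothed_continuous)
next
  case (Suc m)
  have "(\<forall>x\<in>D. has_partial D i f x) \<and> cont_diff d D m (partial D i f)" if i: "i < d" for i
  proof -
    have kr: "k < r" using Suc.prems(2) by simp
    obtain h' where h': "smoothed d r \<delta> m (Suc k) h'"
      and der: "\<And>x. ((\<lambda>t. h (x(i := t))) has_real_derivative h' x) (at (x i))"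
      using smoothed_derivative[OF Suc.prems(1) i kr \<open>\<delta> > 0\<close>] by blast
    note part = has_partial_within[OF D i _ Suc.prems(3) der]
    show ?thesis
    proof
      show "\<forall>x\<in>D. has_partial D i f x"
        using part by blast
      show "cont_diff d D m (partial D i f)"
        using Suc.prems(2) by (intro Suc.IH[OF h'] part) auto
    qed
  qed
  then show ?case
    using continuous_map_restrict[OF smoothed_continuous[OF Suc.prems(1)] Suc.prems(3)] by simp
qed

lemma iterated_partial_smoothed:
  assumes D: "accessible d D" and "\<delta> > 0" and "i < d"
    and h: "smoothed d r \<delta> m k h" and le: "k + m \<le> r" and eq: "\<And>y. y \<in> D \<Longrightarrow> f y = h y"
    and "b \<le> m"
  shows "\<exists>h'. smoothed d r \<delta> (m - b) (k + b) h' \<and> (\<forall>y\<in>D. (partial D i ^^ b) f y = h' y)"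
  using \<open>b \<le> m\<close>
proof (induction b)
  case 0
  then show ?case using h eq by auto
next
  case (Suc b)
  then obtain h' where h': "smoothed d r \<delta> (m - b) (k + b) h'"
    and eq': "\<And>y. y \<in> D \<Longrightarrow> (partial D i ^^ b) f y = h' y"
    by auto
  have "m - b = Suc (m - Suc b)" and "k + b < r"
    using Suc.prems le by auto
  then obtain h'' where "smoothed d r \<delta> (m - Suc b) (Suc (k + b)) h''"
      and der: "\<And>x. ((\<lambda>t. h' (x(i := t))) has_real_derivative h'' x) (at (x i))"
    using smoothed_derivative[OF _ \<open>i < d\<close> _ \<open>\<delta> > 0\<close>] h' by metis
  then show ?case
    using has_partial_within(2)[OF D \<open>i < d\<close> _ eq' der] by (auto intro!: exI[of _ h''])
qed

lemma multi_partial_smoothed: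
  assumes D: "accessible d D" and "\<delta> > 0"
    and h: "smoothed d r \<delta> r 0 h" and eq: "\<And>y. y \<in> D \<Longrightarrow> f y = h y"
    and "j \<le> d" and "(\<Sum>i<j. \<beta> i) \<le> r"
  shows "\<exists>h'. smoothed d r \<delta> (r - (\<Sum>i<j. \<beta> i)) (\<Sum>i<j. \<beta> i) h' \<and>
    (\<forall>y\<in>D. multi_partial D \<beta> j f y = h' y)"
  using assms(5,6)
proof (induction j)
  case 0
  then show ?case using h eq by auto
next
  case (Suc j)
  let ?s = "\<Sum>i<j. \<beta> i"
  from Suc obtain h' where h': "smoothed d r \<delta> (r - ?s) ?s h'"
    and eq': "\<And>y. y \<in> D \<Longrightarrow> multi_partial D \<beta> j f y = h' y"
    by auto
  have "\<exists>h''. smoothed d r \<delta> (r - ?s - \<beta> j) (?s + \<beta> j) h'' \<and>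
      (\<forall>y\<in>D. (partial D j ^^ \<beta> j) (multi_partial D \<beta> j f) y = h'' y)"
    by (rule iterated_partial_smoothed[OF D \<open>\<delta> > 0\<close> _ h' _ eq']) (use Suc.prems in auto)
  then show ?case by simp
qed

lemma smoothed_in_C_class:
  assumes D: "accessible d D" and "0 < \<delta>" "\<delta> \<le> 1" and h: "smoothed d r \<delta> r 0 h"
  shows "h \<in> C_class d D r"
proof -
  have "(SUP x\<in>D. ereal \<bar>multi_partial D \<beta> d h x\<bar>) \<le> 1" if le: "(\<Sum>i<d. \<beta> i) \<le> r" for \<beta>
  proof -
    obtain h' where h': "smoothed d r \<delta> (r - (\<Sum>i<d. \<beta> i)) (\<Sum>i<d. \<beta> i) h'"
      and eq: "\<forall>y\<in>D. multi_partial D \<beta> d h y = h' y"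
      using multi_partial_smoothed[OF D \<open>0 < \<delta>\<close> h _ order_refl le, of h] by blast
    show ?thesis
      by (rule SUP_least) (use smoothed_le_1[OF h' assms(2,3)] eq in auto)
  qed
  moreover have "cont_diff d D r h"
    by (rule cont_diff_smoothed[OF D \<open>0 < \<delta>\<close> h]) auto
  ultimately show ?thesis
    by (simp add: C_class_def)
qed

section \<open>Fooling functions\<close>

definition l1_dist :: "nat \<Rightarrow> point \<Rightarrow> point \<Rightarrow> real" where
  "l1_dist d x p = (\<Sum>i<d. \<bar>x i - p i\<bar>)"

text \<open>Without sample points every point counts as far away, so the value is the full height \<open>H\<close>.\<close>

fun trunc_dist :: "nat \<Rightarrow> real \<Rightarrow> real \<Rightarrow> point list \<Rightarrow> point \<Rightarrow> real" where
  "trunc_dist d R H [] x = H"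
| "trunc_dist d R H (p # ps) x = min (max 0 (l1_dist d x p - R)) (trunc_dist d R H ps x)"

lemma trunc_dist_bounds:
  assumes "H \<ge> 0"
  shows "0 \<le> trunc_dist d R H ps x" "trunc_dist d R H ps x \<le> H"
  using assms by (induction ps) auto

lemma continuous_on_trunc_dist: "continuous_on UNIV (trunc_dist d R H ps)"
proof (induction ps)
  case Nil
  have "trunc_dist d R H [] = (\<lambda>_. H)" by auto
  then show ?case by simp
next
  case (Cons p ps)
  have "trunc_dist d R H (p # ps) = (\<lambda>x. min (max 0 (l1_dist d x p - R)) (trunc_dist d R H ps x))"
    by auto
  moreover have "continuous_on UNIV (\<lambda>x. l1_dist d x p)"
    unfolding l1_dist_def by (intro continuous_on_sum continuous_on_rabs continuous_on_diff continuous_on_coord continuous_on_const)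
  ultimately show ?case
    using Cons by (auto intro!: continuous_on_min continuous_on_max continuous_on_diff continuous_on_const)
qed

lemma l1_dist_triangle: "\<bar>l1_dist d x p - l1_dist d y p\<bar> \<le> l1_dist d x y"
  unfolding l1_dist_def sum_subtractf[symmetric]
  by (rule order_trans[OF sum_abs]) (auto intro!: sum_mono)

lemma trunc_dist_Lipschitz:
  "\<bar>trunc_dist d R H ps x - trunc_dist d R H ps y\<bar> \<le> l1_dist d x y"
proof (induction ps)
  case Nil
  then show ?case by (simp add: l1_dist_def sum_nonneg)
next
  case (Cons p ps)
  then show ?case
    using l1_dist_triangle[of d x p y] by (simp add: min_def max_def abs_le_iff)
qed

lemma trunc_dist_near: "p \<in> set ps \<Longrightarrow> H \<ge> 0 \<Longrightarrow> l1_dist d x p \<le> R \<Longrightarrow> trunc_dist d R H ps x = 0"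
proof (induction ps)
  case (Cons q ps)
  then show ?case
    using trunc_dist_bounds(1)[of H d R ps x] by (cases "q = p") auto
qed simp

lemma trunc_dist_far: "(\<And>p. p \<in> set ps \<Longrightarrow> R + H \<le> l1_dist d x p) \<Longrightarrow> H \<ge> 0 \<Longrightarrow> trunc_dist d R H ps x = H"
proof (induction ps)
  case (Cons q ps)
  then have "trunc_dist d R H ps x = H" by simp
  moreover have "R + H \<le> l1_dist d x q" using Cons.prems(1) by simp
  ultimately show ?case by simp
qed simp

lemma l1_dist_le:
  assumes "\<And>i. i < d \<Longrightarrow> \<bar>x i - y i\<bar> \<le> c"
  shows "l1_dist d x y \<le> real d * c"
  unfolding l1_dist_def using sum_bounded_above[of "{..<d}" "\<lambda>i. \<bar>x i - y i\<bar>" c] assms by simp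

text \<open>The truncated distance is lowered by \<open>R = r d \<delta>\<close> so that it still vanishes on the box of half
side \<open>r \<delta>\<close> around each sample point, which lies in the \<open>\<ell>\<^sup>1\<close>-ball of radius \<open>R\<close>. It
has reached height \<open>H = d \<delta>\<close> at distance \<open>R + H\<close>, and the averages need another \<open>R\<close>, which gives
\<open>2 r + 1\<close>.\<close>

lemma fooling_function:
  assumes D: "accessible d D" and "d \<ge> 1" "r \<ge> 1" "0 < \<delta>" and small: "real d * \<delta> ^ r \<le> 1"
  obtains F where "continuous_on UNIV F" "F \<in> C_class d D r" "(\<lambda>x. - F x) \<in> C_class d D r"
    and "\<And>p. p \<in> set ps \<Longrightarrow> F p = 0"
    and "\<And>x. 0 \<le> F x" "\<And>x. F x \<le> real d * \<delta> ^ r"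
    and "\<And>x. (\<And>p. p \<in> set ps \<Longrightarrow> real (2 * r + 1) * real d * \<delta> \<le> l1_dist d x p) \<Longrightarrow> F x = real d * \<delta> ^ r"
proof -
  have "\<delta> \<le> 1"
  proof (rule ccontr)
    assume "\<not> \<delta> \<le> 1"
    then have "1 < \<delta> ^ r"
      using \<open>r \<ge> 1\<close> by (intro one_less_power) auto
    moreover have "\<delta> ^ r \<le> real d * \<delta> ^ r"
      using \<open>d \<ge> 1\<close> \<open>0 < \<delta>\<close> by (simp add: mult_le_cancel_right1)
    ultimately show False using small by linarith
  qed
  define R H where "R = real r * real d * \<delta>" and "H = real d * \<delta>"
  define u where "u x = \<delta> ^ (r - 1) * trunc_dist d R H ps x" for x
  define w where "w = concat (replicate r [0..<d])"
  define F where "F = avgs \<delta> w u"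
  have "H \<ge> 0" using \<open>0 < \<delta>\<close> by (simp add: H_def)
  have height: "\<delta> ^ (r - 1) * H = real d * \<delta> ^ r"
    using \<open>r \<ge> 1\<close> by (cases r) (auto simp: H_def)
  have cu: "continuous_on UNIV u"
    unfolding u_def by (intro continuous_on_mult continuous_on_const continuous_on_trunc_dist)
  have u_bounds: "0 \<le> u x" "u x \<le> real d * \<delta> ^ r" for x
    unfolding u_def height[symmetric]
    using trunc_dist_bounds[OF \<open>H \<ge> 0\<close>] \<open>0 < \<delta>\<close> by (auto intro!: mult_left_mono)
  have u_Lip: "\<bar>u (x(i := s)) - u (x(i := t))\<bar> \<le> \<delta> ^ (r - 1) * \<bar>s - t\<bar>" if "i < d" for i x s t
  proof -
    have "l1_dist d (x(i := s)) (x(i := t)) = (\<Sum>j<d. if j = i then \<bar>s - t\<bar> else 0)"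
      unfolding l1_dist_def by (intro sum.cong) auto
    also have "\<dots> = \<bar>s - t\<bar>" using that by simp
    finally have *: "\<bar>trunc_dist d R H ps (x(i := s)) - trunc_dist d R H ps (x(i := t))\<bar> \<le> \<bar>s - t\<bar>"
      using trunc_dist_Lipschitz[of d R H ps "x(i := s)" "x(i := t)"] by simp
    have "\<bar>u (x(i := s)) - u (x(i := t))\<bar> =
        \<delta> ^ (r - 1) * \<bar>trunc_dist d R H ps (x(i := s)) - trunc_dist d R H ps (x(i := t))\<bar>"
      unfolding u_def right_diff_distrib[symmetric] abs_mult using \<open>0 < \<delta>\<close> by simp
    with * show ?thesis
      using \<open>0 < \<delta>\<close> by (auto intro!: mult_left_mono)
  qed
  have count: "count_list w i = (if i < d then r else 0)" for i
  proof -
    have 1: "count_list [0..<d] i = (if i < d then 1 else 0)"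
      by (induction d) (auto simp: less_Suc_eq)
    show ?thesis
      unfolding w_def by (induction r) (auto simp: 1)
  qed
  have rough: "rough d r \<delta> 0 u" "rough d r \<delta> 0 (\<lambda>x. - u x)"
  proof -
    have "\<bar>u x\<bar> \<le> 1" for x
      using u_bounds[of x] small by linarith
    then show "rough d r \<delta> 0 u" "rough d r \<delta> 0 (\<lambda>x. - u x)"
      using cu u_Lip by (auto simp: rough_def intro!: continuous_on_minus simp: abs_minus_commute)
  qed
  have neg: "avgs \<delta> w (\<lambda>x. - u x) = (\<lambda>x. - F x)"
    unfolding F_def by (induction w) (auto simp: avg_def)
  have near_u: "l1_dist d y x \<le> R" if "\<And>i. \<bar>y i - x i\<bar> \<le> real (count_list w i) * \<delta>" for x y
  proof -
    have "\<bar>y i - x i\<bar> \<le> real r * \<delta>" if "i < d" for i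
      using \<open>\<And>i. \<bar>y i - x i\<bar> \<le> real (count_list w i) * \<delta>\<close>[of i] that by (simp add: count)
    from l1_dist_le[OF this, of d] show ?thesis
      by (simp add: R_def mult_ac)
  qed
  show ?thesis
  proof
    show "continuous_on UNIV F"
      unfolding F_def by (rule continuous_on_avgs[OF cu])
    show "F \<in> C_class d D r"
      by (rule smoothed_in_C_class[OF D \<open>0 < \<delta>\<close> \<open>\<delta> \<le> 1\<close>])
         (auto simp: smoothed_def F_def count intro!: exI[of _ w] exI[of _ u] rough)
    show "(\<lambda>x. - F x) \<in> C_class d D r"
      unfolding neg[symmetric]
      by (rule smoothed_in_C_class[OF D \<open>0 < \<delta>\<close> \<open>\<delta> \<le> 1\<close>])
         (auto simp: smoothed_def count intro!: exI[of _ w] exI[of _ "\<lambda>x. - u x"] rough)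
    show "0 \<le> F x" "F x \<le> real d * \<delta> ^ r" for x
      unfolding F_def using avgs_bound[OF cu \<open>0 < \<delta>\<close> u_bounds] by auto
    show "F p = 0" if "p \<in> set ps" for p
      unfolding F_def
    proof (rule avgs_local_const[OF \<open>0 < \<delta>\<close>])
      fix y assume "\<And>i. \<bar>y i - p i\<bar> \<le> real (count_list w i) * \<delta>"
      then have "l1_dist d y p \<le> R"
        by (rule near_u)
      then show "u y = 0"
        using trunc_dist_near[OF that \<open>H \<ge> 0\<close>] by (simp add: u_def)
    qed
    show "F x = real d * \<delta> ^ r"
      if far: "\<And>p. p \<in> set ps \<Longrightarrow> real (2 * r + 1) * real d * \<delta> \<le> l1_dist d x p" for x
      unfolding F_def
    proof (rule avgs_local_const[OF \<open>0 < \<delta>\<close>])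
      fix y assume "\<And>i. \<bar>y i - x i\<bar> \<le> real (count_list w i) * \<delta>"
      then have "l1_dist d y x \<le> R"
        by (rule near_u)
      then have "R + H \<le> l1_dist d y p" if "p \<in> set ps" for p
        using far[OF that] l1_dist_triangle[of d y p x] by (simp add: R_def H_def algebra_simps)
      then show "u y = real d * \<delta> ^ r"
        using trunc_dist_far[OF _ \<open>H \<ge> 0\<close>] height by (simp add: u_def)
    qed
  qed
qed

section \<open>The lower bound\<close>

text \<open>The points of the product space are undefined outside the index set, so all their coordinates are
measurable and the inclusion into the full function space is Borel measurable.\<close>

lemma borel_measurable_PiM_continuous:
  fixes f :: "point \<Rightarrow> real"
  assumes f: "continuous_on UNIV f" and M: "\<And>i. i < d \<Longrightarrow> sets (M i) = sets borel"
  shows "f \<in> borel_measurable (Pi\<^sub>M {..<d} M)"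
proof -
  have "(\<lambda>x. x :: point) \<in> borel_measurable (Pi\<^sub>M {..<d} M)"
  proof (rule measurable_coordinatewise_then_product)
    fix k
    show "(\<lambda>x. x k) \<in> borel_measurable (Pi\<^sub>M {..<d} M)"
    proof (cases "k < d")
      case True
      then have "(\<lambda>x. x k) \<in> measurable (Pi\<^sub>M {..<d} M) (M k)"
        by (intro measurable_component_singleton) simp
      then show ?thesis
        using M[OF True] measurable_cong_sets by blast
    next
      case False
      then have "x k = undefined" if "x \<in> space (Pi\<^sub>M {..<d} M)" for x
        using that by (auto simp: space_PiM PiE_def extensional_def)
      then show ?thesis
        by (subst measurable_cong[where g = "\<lambda>_. undefined"]) auto
    qed
  qed
  from measurable_compose[OF this borel_measurable_continuous_onI[OF f]] show ?thesis .
qed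

lemma nn_integral_exp_abs: "(\<integral>\<^sup>+t. ennreal (exp (- \<bar>t\<bar>)) \<partial>lborel) \<le> ennreal 2"
proof -
  have half: "(\<integral>\<^sup>+t. ennreal (exp (- t)) * indicator {0..} t \<partial>lborel) = 1"
  proof -
    have "(\<integral>\<^sup>+t. ennreal (exp (- t)) * indicator {0..} t \<partial>lborel) = ennreal (0 - (- exp (- 0)))"
    proof (rule nn_integral_FTC_atLeast)
      show "((\<lambda>t. - exp (- t)) has_real_derivative exp (- x)) (at x)" for x :: real
        by (auto intro!: derivative_eq_intros)
      have "((\<lambda>t :: real. exp (- t)) \<longlongrightarrow> 0) at_top"
        by (rule filterlim_compose[OF exp_at_bot filterlim_uminus_at_bot_at_top])
      from tendsto_minus[OF this] show "((\<lambda>t :: real. - exp (- t)) \<longlongrightarrow> 0) at_top"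
        by simp
    qed auto
    then show ?thesis by simp
  qed
  have half': "(\<integral>\<^sup>+t. ennreal (exp t) * indicator {..0} t \<partial>lborel) = 1"
  proof -
    have "(\<integral>\<^sup>+t. ennreal (exp t) * indicator {..0} t \<partial>lborel) =
        ennreal \<bar>-1\<bar> * (\<integral>\<^sup>+t. ennreal (exp (0 + (-1) * t)) * indicator {..0} (0 + (-1) * t) \<partial>lborel)"
      by (rule nn_integral_real_affine) auto
    also have "(\<integral>\<^sup>+t. ennreal (exp (0 + (-1) * t)) * indicator {..0} (0 + (-1) * t) \<partial>lborel) =
        (\<integral>\<^sup>+t. ennreal (exp (- t)) * indicator {0..} t \<partial>lborel)"
      by (intro nn_integral_cong) (auto simp: indicator_def)
    finally show ?thesis using half by simp
  qed
  have "(\<integral>\<^sup>+t. ennreal (exp (- \<bar>t\<bar>)) \<partial>lborel) \<le>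
      (\<integral>\<^sup>+t. ennreal (exp (- t)) * indicator {0..} t + ennreal (exp t) * indicator {..0} t \<partial>lborel)"
    by (intro nn_integral_mono) (auto simp: indicator_def abs_if)
  also have "\<dots> = ennreal 2"
    by (subst nn_integral_add) (use half half' in auto)
  finally show ?thesis .
qed

lemma nn_integral_exp_scaled:
  assumes "a > 0"
  shows "(\<integral>\<^sup>+t. ennreal (exp (1 - \<bar>t - c\<bar> / a)) \<partial>lborel) \<le> ennreal (2 * exp 1 * a)"
proof -
  have "(\<integral>\<^sup>+t. ennreal (exp (1 - \<bar>t - c\<bar> / a)) \<partial>lborel) =
      ennreal \<bar>a\<bar> * (\<integral>\<^sup>+t. ennreal (exp (1 - \<bar>(c + a * t) - c\<bar> / a)) \<partial>lborel)"
    using assms by (intro nn_integral_real_affine) auto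
  also have "(\<integral>\<^sup>+t. ennreal (exp (1 - \<bar>(c + a * t) - c\<bar> / a)) \<partial>lborel) =
      (\<integral>\<^sup>+t. ennreal (exp 1) * ennreal (exp (- \<bar>t\<bar>)) \<partial>lborel)"
  proof (rule nn_integral_cong)
    fix t :: real
    show "ennreal (exp (1 - \<bar>(c + a * t) - c\<bar> / a)) = ennreal (exp 1) * ennreal (exp (- \<bar>t\<bar>))"
      using assms by (simp add: abs_mult ennreal_mult[symmetric] exp_add[symmetric])
  qed
  also have "\<dots> = ennreal (exp 1) * (\<integral>\<^sup>+t. ennreal (exp (- \<bar>t\<bar>)) \<partial>lborel)"
    by (rule nn_integral_cmult) measurable
  also have "ennreal \<bar>a\<bar> * \<dots> \<le> ennreal \<bar>a\<bar> * (ennreal (exp 1) * ennreal 2)"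
    by (intro mult_left_mono nn_integral_exp_abs) auto
  also have "\<dots> = ennreal (\<bar>a\<bar> * (exp 1 * 2))"
    by (simp only: ennreal_mult abs_ge_zero exp_ge_zero mult_nonneg_nonneg zero_le_numeral)
  also have "\<bar>a\<bar> * (exp 1 * 2) = 2 * exp 1 * a"
    using assms by simp
  finally show ?thesis .
qed

definition l1_ball :: "nat \<Rightarrow> point \<Rightarrow> real \<Rightarrow> point set" where
  "l1_ball d p R = {x \<in> space (rn_lborel d). l1_dist d x p < R}"

lemma sets_l1_ball [measurable]: "l1_ball d p R \<in> sets (rn_lborel d)"
proof -
  have "continuous_on UNIV (\<lambda>x. l1_dist d x p)"
    unfolding l1_dist_def
    by (intro continuous_on_sum continuous_on_rabs continuous_on_diff continuous_on_coord continuous_on_const)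
  then have "(\<lambda>x. l1_dist d x p) \<in> borel_measurable (rn_lborel d)"
    unfolding rn_lborel_def by (rule borel_measurable_PiM_continuous) simp
  then show ?thesis
    unfolding l1_ball_def by measurable
qed

text \<open>Chernoff's bound: on the ball \<open>exp (d - l1_dist d x p / a)\<close> is at least one, and its integral is a
product of one-dimensional integrals. This is as good as the exact volume up to a factor that is
polynomial in \<open>d\<close>.\<close>

lemma emeasure_l1_ball_le:
  assumes "a > 0"
  shows "emeasure (rn_lborel d) (l1_ball d p (real d * a)) \<le> ennreal ((2 * exp 1 * a) ^ d)"
proof -
  interpret product_sigma_finite "\<lambda>_::nat. lborel :: real measure" by standard
  let ?B = "l1_ball d p (real d * a)"
  let ?g = "\<lambda>i t. ennreal (exp (1 - \<bar>t - p i\<bar> / a))"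
  have "emeasure (rn_lborel d) ?B = (\<integral>\<^sup>+x. indicator ?B x \<partial>rn_lborel d)"
    by simp
  also have "\<dots> \<le> (\<integral>\<^sup>+x. (\<Prod>i<d. ?g i (x i)) \<partial>rn_lborel d)"
  proof (rule nn_integral_mono)
    fix x
    show "indicator ?B x \<le> (\<Prod>i<d. ?g i (x i))"
    proof (cases "x \<in> ?B")
      case True
      then have "l1_dist d x p / a \<le> real d"
        using assms by (simp add: l1_ball_def pos_divide_le_eq)
      then have "0 \<le> (\<Sum>i<d. 1 - \<bar>x i - p i\<bar> / a)"
        by (simp add: sum_subtractf l1_dist_def sum_divide_distrib)
      then have "1 \<le> exp (\<Sum>i<d. 1 - \<bar>x i - p i\<bar> / a)"
        by simp
      also have "\<dots> = (\<Prod>i<d. exp (1 - \<bar>x i - p i\<bar> / a))"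
        by (rule exp_sum) simp
      finally have "ennreal 1 \<le> ennreal (\<Prod>i<d. exp (1 - \<bar>x i - p i\<bar> / a))"
        by (rule ennreal_leI)
      then show ?thesis
        using True by (simp add: prod_ennreal)
    qed simp
  qed
  also have "\<dots> = (\<Prod>i<d. \<integral>\<^sup>+t. ?g i t \<partial>lborel)"
    unfolding rn_lborel_def by (rule product_nn_integral_prod) auto
  also have "\<dots> \<le> (\<Prod>i<d. ennreal (2 * exp 1 * a))"
    by (intro prod_mono_ennreal nn_integral_exp_scaled assms)
  also have "\<dots> = ennreal ((2 * exp 1 * a) ^ d)"
    using assms by (simp add: ennreal_power)
  finally show ?thesis .
qed

lemma emeasure_l1_balls_le:
  assumes "a > 0"
  shows "emeasure (rn_lborel d) (\<Union>p\<in>set ps. l1_ball d p (real d * a))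
    \<le> ennreal (real (length ps) * (2 * exp 1 * a) ^ d)"
proof -
  have "emeasure (rn_lborel d) (\<Union>p\<in>set ps. l1_ball d p (real d * a))
      \<le> (\<Sum>p\<in>set ps. emeasure (rn_lborel d) (l1_ball d p (real d * a)))"
    by (rule emeasure_subadditive_finite) auto
  also have "\<dots> \<le> (\<Sum>p\<in>set ps. ennreal ((2 * exp 1 * a) ^ d))"
    by (intro sum_mono emeasure_l1_ball_le assms)
  also have "\<dots> = ennreal (real (card (set ps)) * (2 * exp 1 * a) ^ d)"
    using assms by (simp add: ennreal_mult' ennreal_of_nat_eq_real_of_nat)
  also have "\<dots> \<le> ennreal (real (length ps) * (2 * exp 1 * a) ^ d)"
    using assms by (intro ennreal_leI mult_right_mono) (auto simp: card_length)
  finally show ?thesis .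
qed

lemma info_eqI:
  assumes "\<And>k. k < n \<Longrightarrow> f (\<psi> (info \<psi> k g)) = g (\<psi> (info \<psi> k g))"
  shows "info \<psi> n f = info \<psi> n g"
  using assms by (induction n) auto

text \<open>An adaptive algorithm that only ever sees zeros samples at points that do not depend on the input.
It returns the same value for \<open>F\<close> and \<open>- F\<close>, whose integrals differ by at least \<open>2 c\<close>.\<close>

lemma minimal_error_geI:
  assumes "\<And>ps. length ps = n \<Longrightarrow> set ps \<subseteq> D \<Longrightarrow>
    \<exists>F. F \<in> C_class d D r \<and> (\<lambda>x. - F x) \<in> C_class d D r \<and> (\<forall>p\<in>set ps. F p = 0) \<and> c \<le> integral_on d D F"
  shows "ereal c \<le> minimal_error d D r n"
  unfolding minimal_error_def
proof (rule INF_greatest)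
  fix A assume "A \<in> algorithms D n"
  then obtain \<psi> \<phi> where \<psi>: "\<And>ys. \<psi> ys \<in> D" and A: "A = (\<lambda>f. \<phi> (info \<psi> n f))"
    by (auto simp: algorithms_def)
  define ps where "ps = map (\<lambda>k. \<psi> (info \<psi> k (\<lambda>_. 0))) [0..<n]"
  obtain F where F: "F \<in> C_class d D r" "(\<lambda>x. - F x) \<in> C_class d D r"
    and zero: "\<And>p. p \<in> set ps \<Longrightarrow> F p = 0" and int: "c \<le> integral_on d D F"
    using assms[of ps] \<psi> by (auto simp: ps_def)
  define a where "a = \<phi> (info \<psi> n (\<lambda>_. 0))"
  have "info \<psi> n F = info \<psi> n (\<lambda>_. 0)" "info \<psi> n (\<lambda>x. - F x) = info \<psi> n (\<lambda>_. 0)"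
    by (intro info_eqI; simp add: zero ps_def)+
  then have A_eq: "A F = a" "A (\<lambda>x. - F x) = a"
    by (simp_all add: A a_def)
  have neg: "integral_on d D (\<lambda>x. - F x) = - integral_on d D F"
    by (simp add: integral_on_def set_lebesgue_integral_def)
  have "\<bar>integral_on d D F - A F\<bar> \<ge> c \<or> \<bar>integral_on d D (\<lambda>x. - F x) - A (\<lambda>x. - F x)\<bar> \<ge> c"
    unfolding A_eq neg using int by linarith
  then show "ereal c \<le> worst_case_error d D r A"
    unfolding worst_case_error_def
    using SUP_upper2[OF F(1), of "ereal c" "\<lambda>f. ereal \<bar>integral_on d D f - A f\<bar>"]
      SUP_upper2[OF F(2), of "ereal c" "\<lambda>f. ereal \<bar>integral_on d D f - A f\<bar>"] by auto
qed

text \<open>The second factor bounds from below the part of \<open>D\<close> that the \<open>\<ell>\<^sup>1\<close>-balls around \<open>n\<close> points leave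
uncovered; there the fooling function has its full height.\<close>

lemma minimal_error_lower:
  assumes D: "accessible d D" and meas: "emeasure (rn_lborel d) D = 1"
    and "d \<ge> 1" "r \<ge> 1" "0 < \<delta>" and small: "real d * \<delta> ^ r \<le> 1"
  shows "ereal (real d * \<delta> ^ r * (1 - real n * (2 * exp 1 * (real (2 * r + 1) * \<delta>)) ^ d))
    \<le> minimal_error d D r n"
proof (rule minimal_error_geI)
  fix ps :: "point list" assume len: "length ps = n" and "set ps \<subseteq> D"
  define a where "a = real (2 * r + 1) * \<delta>"
  have "a > 0" using \<open>0 < \<delta>\<close> by (simp add: a_def)
  define V where "V = real d * \<delta> ^ r"
  have "V > 0" using \<open>0 < \<delta>\<close> \<open>d \<ge> 1\<close> by (simp add: V_def)
  define U where "U = (\<Union>p\<in>set ps. l1_ball d p (real d * a))"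
  have D_sets: "D \<in> sets (rn_lborel d)"
    using meas emeasure_notin_sets by fastforce
  have U_sets: "U \<in> sets (rn_lborel d)"
    by (auto simp: U_def)
  obtain F where cF: "continuous_on UNIV F" and F: "F \<in> C_class d D r" "(\<lambda>x. - F x) \<in> C_class d D r"
    and zero: "\<And>p. p \<in> set ps \<Longrightarrow> F p = 0"
    and F0: "\<And>x. 0 \<le> F x" and FV: "\<And>x. F x \<le> V"
    and far: "\<And>x. (\<And>p. p \<in> set ps \<Longrightarrow> real (2 * r + 1) * real d * \<delta> \<le> l1_dist d x p) \<Longrightarrow> F x = V"
    unfolding V_def by (rule fooling_function[OF D \<open>d \<ge> 1\<close> \<open>r \<ge> 1\<close> \<open>0 < \<delta>\<close> small, of ps]) blast
  have F_meas: "F \<in> borel_measurable (rn_lborel d)"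
    unfolding rn_lborel_def by (rule borel_measurable_PiM_continuous[OF cF]) simp
  have FU: "F x = V" if "x \<in> D - U" for x
  proof (rule far)
    fix p assume "p \<in> set ps"
    have "x \<in> space (rn_lborel d)"
      using D_sets that sets.sets_into_space by blast
    then show "real (2 * r + 1) * real d * \<delta> \<le> l1_dist d x p"
      using that \<open>p \<in> set ps\<close> by (auto simp: U_def l1_ball_def a_def not_less mult_ac)
  qed
  have fin: "emeasure (rn_lborel d) (D - U) < \<infinity>"
    using emeasure_mono[of "D - U" D "rn_lborel d"] D_sets meas
    by (auto intro: le_less_trans[OF _ ennreal_one_less_top])
  have "V * (1 - real n * (2 * exp 1 * a) ^ d) \<le> V * measure (rn_lborel d) (D - U)"
  proof (rule mult_left_mono)
    \<comment> \<open>The covered part has measure at most \<open>n\<close> times that of one ball.\<close>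
    have "1 = emeasure (rn_lborel d) D" using meas by simp
    also have "\<dots> \<le> emeasure (rn_lborel d) ((D - U) \<union> U)"
      using D_sets U_sets by (intro emeasure_mono) auto
    also have "\<dots> \<le> emeasure (rn_lborel d) (D - U) + emeasure (rn_lborel d) U"
      using D_sets U_sets by (intro emeasure_subadditive) auto
    also have "\<dots> \<le> ennreal (measure (rn_lborel d) (D - U)) + ennreal (real n * (2 * exp 1 * a) ^ d)"
      using emeasure_l1_balls_le[OF \<open>a > 0\<close>, of d ps] len fin
      by (auto simp: U_def[symmetric] emeasure_eq_ennreal_measure intro!: add_mono)
    also have "\<dots> = ennreal (measure (rn_lborel d) (D - U) + real n * (2 * exp 1 * a) ^ d)"
      using \<open>a > 0\<close> by simp
    finally have "1 \<le> measure (rn_lborel d) (D - U) + real n * (2 * exp 1 * a) ^ d"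
      by (simp add: ennreal_1[symmetric] ennreal_le_iff2 del: ennreal_1)
    then show "1 - real n * (2 * exp 1 * a) ^ d \<le> measure (rn_lborel d) (D - U)" by simp
  qed (use \<open>V > 0\<close> in simp)
  also have "\<dots> = (\<integral>x. V * indicator (D - U) x \<partial>rn_lborel d)"
    using D_sets U_sets fin by simp
  also have "\<dots> \<le> (\<integral>x. indicator D x *\<^sub>R F x \<partial>rn_lborel d)"
  proof (rule integral_mono)
    show "integrable (rn_lborel d) (\<lambda>x. V * indicator (D - U) x)"
      using D_sets U_sets fin by (intro integrable_mult_right) (auto simp: integrable_indicator_iff)
    show "integrable (rn_lborel d) (\<lambda>x. indicator D x *\<^sub>R F x)"
      using D_sets F_meas meas F0 FV
      by (intro integrableI_bounded_set_indicator[where B = V]) auto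
    show "V * indicator (D - U) x \<le> indicator D x *\<^sub>R F x" for x
      using FU[of x] F0[of x] by (auto simp: indicator_def)
  qed
  also have "\<dots> = integral_on d D F"
    by (simp add: integral_on_def set_lebesgue_integral_def)
  finally show "\<exists>F. F \<in> C_class d D r \<and> (\<lambda>x. - F x) \<in> C_class d D r \<and> (\<forall>p\<in>set ps. F p = 0) \<and>
      real d * \<delta> ^ r * (1 - real n * (2 * exp 1 * (real (2 * r + 1) * \<delta>)) ^ d) \<le> integral_on d D F"
    using F zero unfolding V_def a_def by blast
qed

text \<open>The fooling function of height \<open>d \<delta>\<^sup>r = 2 \<epsilon>\<close> fits into the class because \<open>\<epsilon> < 1/2\<close>, and its
integral exceeds \<open>\<epsilon>\<close> as soon as the balls cover less than half of \<open>D\<close>. Each ball has volume at most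
\<open>K ^ d\<close>, so \<open>n \<ge> (1/2) / K ^ d\<close>, and the factor one half is absorbed into \<open>c ^ d\<close>.\<close>

lemma info_complexity_lower:
  assumes D: "accessible d D" and meas: "emeasure (rn_lborel d) D = 1"
    and "d \<ge> 1" "r \<ge> 1" "0 < \<epsilon>" "\<epsilon> < 1/2"
    and c_def: "c = 1 / (4 * exp 1 * real (2 * r + 1) * 2 powr (1 / real r))"
  shows "ereal (c ^ d * (real d / \<epsilon>) powr (real d / real r)) \<le> ereal_of_enat (info_complexity \<epsilon> d D r)"
proof -
  define \<delta> where "\<delta> = (2 * \<epsilon> / real d) powr (1 / real r)"
  define K where "K = 2 * exp 1 * (real (2 * r + 1) * \<delta>)"
  have "\<delta> > 0" using assms by (simp add: \<delta>_def)
  then have "K > 0" by (simp add: K_def)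
  have "\<delta> ^ r = 2 * \<epsilon> / real d"
    using \<open>\<delta> > 0\<close> assms by (simp add: \<delta>_def powr_powr flip: powr_realpow)
  then have V: "real d * \<delta> ^ r = 2 * \<epsilon>"
    using \<open>d \<ge> 1\<close> by simp
  have "c ^ d * (real d / \<epsilon>) powr (real d / real r) = (c * (real d / \<epsilon>) powr (1 / real r)) ^ d"
  proof -
    have "(real d / \<epsilon>) powr (real d / real r) = ((real d / \<epsilon>) powr (1 / real r)) powr real d"
      by (simp add: powr_powr)
    also have "\<dots> = ((real d / \<epsilon>) powr (1 / real r)) ^ d"
      using assms by (intro powr_realpow) simp
    finally show ?thesis by (simp add: power_mult_distrib)
  qed
  also have "c * (real d / \<epsilon>) powr (1 / real r) = 1 / (2 * K)"
  proof -
    have "2 powr (1 / real r) = \<delta> * (real d / \<epsilon>) powr (1 / real r)"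
      unfolding \<delta>_def using assms by (subst powr_mult[symmetric]) auto
    moreover have "(real d / \<epsilon>) powr (1 / real r) > 0" using assms by simp
    ultimately show ?thesis
      using \<open>\<delta> > 0\<close> by (simp add: c_def K_def)
  qed
  finally have eq: "c ^ d * (real d / \<epsilon>) powr (real d / real r) = (1 / (2 * K)) ^ d" .
  have "ereal ((1 / (2 * K)) ^ d) \<le> ereal_of_enat (enat n)" if "minimal_error d D r n \<le> ereal \<epsilon>" for n
  proof -
    have "ereal (2 * \<epsilon> * (1 - real n * K ^ d)) \<le> ereal \<epsilon>"
    proof (rule order_trans[OF _ that])
      show "ereal (2 * \<epsilon> * (1 - real n * K ^ d)) \<le> minimal_error d D r n"
        unfolding V[symmetric] K_def
        by (rule minimal_error_lower[OF D meas \<open>d \<ge> 1\<close> \<open>r \<ge> 1\<close> \<open>\<delta> > 0\<close>]) (use V \<open>\<epsilon> < 1/2\<close> in simp)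
    qed
    then have "\<epsilon> * (2 * (1 - real n * K ^ d)) \<le> \<epsilon> * 1" by (simp only: ereal_less_eq mult_1_right mult.assoc mult.left_commute)
    then have "2 * (1 - real n * K ^ d) \<le> 1"
      using \<open>0 < \<epsilon>\<close> by (simp only: mult_le_cancel_left_pos)
    then have "1 / 2 \<le> real n * K ^ d" by (simp add: algebra_simps)
    moreover have "(1 / 2 :: real) ^ d \<le> 1 / 2"
      using power_decreasing[of 1 d "1 / 2 :: real"] \<open>d \<ge> 1\<close> by simp
    ultimately have "(1 / 2) ^ d \<le> real n * K ^ d" by linarith
    then have "(1 / 2) ^ d / K ^ d \<le> real n"
      using \<open>K > 0\<close> by (simp add: pos_divide_le_eq)
    then show ?thesis
      by (simp add: power_divide power_mult_distrib)
  qed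
  then have "ereal ((1 / (2 * K)) ^ d) \<le> (INF n\<in>{n. minimal_error d D r n \<le> ereal \<epsilon>}. ereal_of_enat (enat n))"
    by (intro INF_greatest) auto
  also have "\<dots> \<le> ereal_of_enat (info_complexity \<epsilon> d D r)"
  proof (cases "{n. minimal_error d D r n \<le> ereal \<epsilon>} = {}")
    case True
    then show ?thesis by (simp add: info_complexity_def top_enat_def)
  next
    case False
    then obtain n where "n \<in> {n. minimal_error d D r n \<le> ereal \<epsilon>}" by blast
    from wellorder_InfI[OF imageI[OF this, of enat]]
    have "info_complexity \<epsilon> d D r \<in> enat ` {n. minimal_error d D r n \<le> ereal \<epsilon>}"
      unfolding info_complexity_def .
    then show ?thesis by (auto intro!: INF_lower)
  qed
  finally show ?thesis unfolding eq .
qed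

lemma accessible_open:
  assumes D: "openin (rn_topology d) D" and "D \<noteq> {}"
  shows "accessible d D"
  unfolding accessible_def
proof (intro conjI ballI allI impI)
  show sub: "D \<subseteq> {..<d} \<rightarrow>\<^sub>E UNIV"
    using openin_subset[OF D] by (simp add: rn_topology_def)
  fix x i assume "x \<in> D" "i < d"
  have "continuous_map euclideanreal (rn_topology d) (\<lambda>t. x(i := t))"
    unfolding rn_topology_def continuous_map_componentwise
    using \<open>x \<in> D\<close> \<open>i < d\<close> sub by (auto simp: PiE_def extensional_def)
  then have "openin euclideanreal {t \<in> topspace euclideanreal. x(i := t) \<in> D}"
    using D by (rule openin_continuous_map_preimage)
  then have "open (line_section D i x)"
    by (simp add: line_section_def)
  moreover have "x i \<in> line_section D i x"
    using \<open>x \<in> D\<close> by (simp add: line_section_def)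
  ultimately have "at (x i) within line_section D i x = at (x i)"
    by (intro at_within_open)
  then show "at (x i) within line_section D i x \<noteq> bot"
    by simp
qed fact

lemma line_section_unit_cube:
  assumes "x \<in> unit_cube d" "i < d"
  shows "line_section (unit_cube d) i x = {0..1}"
proof -
  have "x(i := t) \<in> unit_cube d \<longleftrightarrow> t \<in> {0..1}" for t
  proof
    assume "x(i := t) \<in> unit_cube d"
    then have "(x(i := t)) i \<in> {0..1}"
      unfolding unit_cube_def by (rule PiE_mem) (use \<open>i < d\<close> in simp)
    then show "t \<in> {0..1}" by simp
  next
    assume "t \<in> {0..1}"
    then have "x(i := t) \<in> insert i {..<d} \<rightarrow>\<^sub>E {0..1}"
      using assms(1) unfolding unit_cube_def by (rule PiE_fun_upd)
    then show "x(i := t) \<in> unit_cube d"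
      using \<open>i < d\<close> by (simp add: unit_cube_def insert_absorb)
  qed
  then show ?thesis
    unfolding line_section_def by (intro set_eqI) (simp only: mem_Collect_eq)
qed

lemma accessible_unit_cube: "accessible d (unit_cube d)"
  unfolding accessible_def
proof (intro conjI ballI allI impI)
  show "unit_cube d \<noteq> {}" by (simp add: unit_cube_def PiE_eq_empty_iff)
  show "unit_cube d \<subseteq> {..<d} \<rightarrow>\<^sub>E UNIV" by (auto simp: unit_cube_def PiE_iff)
  fix x i assume x: "x \<in> unit_cube d" and i: "i < d"
  then have "x i \<in> {0..1}" by (auto simp: unit_cube_def PiE_iff)
  then have "x i islimpt {0..1}"
    by (intro connected_imp_perfect) auto
  then show "at (x i) within line_section (unit_cube d) i x \<noteq> bot"
    by (simp add: line_section_unit_cube[OF x i] trivial_limit_within)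
qed

lemma emeasure_unit_cube: "emeasure (rn_lborel d) (unit_cube d) = 1"
proof -
  interpret product_sigma_finite "\<lambda>_::nat. lborel :: real measure" by standard
  have "emeasure (rn_lborel d) (unit_cube d) = (\<Prod>i<d. emeasure lborel {0..1 :: real})"
    unfolding rn_lborel_def unit_cube_def by (rule emeasure_PiM) auto
  then show ?thesis by simp
qed

section \<open>Quadrature with nonnegative weights\<close>

lemma integral_unit_interval_cells:
  fixes f :: "real \<Rightarrow> real"
  assumes f: "f integrable_on {0..1}" and "m > 0"
  shows "integral {0..1} f = (\<Sum>c<m. integral {real c / real m..real (Suc c) / real m} f)"
proof -
  have "integral {0..real k / real m} f = (\<Sum>c<k. integral {real c / real m..real (Suc c) / real m} f)"
    if "k \<le> m" for k
    using that
  proof (induction k)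
    case (Suc k)
    have "f integrable_on {0..real (Suc k) / real m}"
      using f by (rule integrable_subinterval_real) (use Suc.prems in \<open>auto simp: divide_simps\<close>)
    then have "integral {0..real k / real m} f + integral {real k / real m..real (Suc k) / real m} f
        = integral {0..real (Suc k) / real m} f"
      by (intro Henstock_Kurzweil_Integration.integral_combine) (auto simp: divide_right_mono)
    with Suc show ?case by simp
  qed simp
  from this[of m] show ?thesis using \<open>m > 0\<close> by simp
qed

lemma Riemann_sum_error:
  fixes f :: "real \<Rightarrow> real"
  assumes Lip: "\<And>s t. s \<in> {0..1} \<Longrightarrow> t \<in> {0..1} \<Longrightarrow> \<bar>f s - f t\<bar> \<le> C * \<bar>s - t\<bar>"
    and "continuous_on {0..1} f" and "N > 0" and "C \<ge> 0"
  shows "\<bar>integral {0..1} f - (\<Sum>i<N. f (real i / real N)) / real N\<bar> \<le> C / real N"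
proof -
  have int: "f integrable_on {0..1}"
    using assms(2) by (rule integrable_continuous_real)
  have cell: "\<bar>integral {real i / real N..real (Suc i) / real N} f - f (real i / real N) / real N\<bar> \<le> C / real N / real N"
    if "i < N" for i
  proof -
    define a b where "a = real i / real N" and "b = real (Suc i) / real N"
    have ab: "0 \<le> a" "a \<le> b" "b \<le> 1" and len: "b - a = 1 / real N"
      using that by (auto simp: a_def b_def divide_simps)
    have intc: "f integrable_on {a..b}"
      using int by (rule integrable_subinterval_real) (use ab in auto)
    have "integral {a..b} (\<lambda>t. f t - f a) = integral {a..b} f - f a / real N"
      using ab len by (subst integral_diff[OF intc]) auto
    moreover have "norm (integral (cbox a b) (\<lambda>t. f t - f a)) \<le> (C / real N) * measure lborel (cbox a b)"
    proof (rule integrable_bound)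
      show "(\<lambda>t. f t - f a) integrable_on cbox a b"
        using intc by (auto intro!: integrable_diff)
      fix t assume "t \<in> cbox a b"
      then have t: "t \<in> {0..1}" "\<bar>t - a\<bar> \<le> 1 / real N"
        using ab len by auto
      then have "\<bar>f t - f a\<bar> \<le> C * \<bar>t - a\<bar>"
        using Lip[of t a] ab by auto
      also have "\<dots> \<le> C * (1 / real N)"
        using t(2) \<open>C \<ge> 0\<close> by (rule mult_left_mono)
      finally show "norm (f t - f a) \<le> C / real N" by simp
    qed (use \<open>C \<ge> 0\<close> in simp)
    ultimately show ?thesis using ab len by (simp add: a_def b_def)
  qed
  have "integral {0..1} f - (\<Sum>i<N. f (real i / real N)) / real N =
      (\<Sum>i<N. integral {real i / real N..real (Suc i) / real N} f - f (real i / real N) / real N)"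
    unfolding integral_unit_interval_cells[OF int \<open>N > 0\<close>]
    by (simp add: sum_subtractf sum_divide_distrib)
  also have "\<bar>\<dots>\<bar> \<le> (\<Sum>i<N. C / real N / real N)"
    by (intro order_trans[OF sum_abs] sum_mono cell) auto
  also have "\<dots> = C / real N"
    using \<open>N > 0\<close> by simp
  finally show ?thesis .
qed

definition Lagrange_poly :: "(nat \<Rightarrow> real) \<Rightarrow> nat \<Rightarrow> nat \<Rightarrow> real poly" where
  "Lagrange_poly x r j = (\<Prod>k\<in>{..<r} - {j}. smult (1 / (x j - x k)) [:- x k, 1:])"

lemma poly_Lagrange_poly:
  "poly (Lagrange_poly x r j) t = (\<Prod>k\<in>{..<r} - {j}. (t - x k) / (x j - x k))"
  unfolding Lagrange_poly_def poly_prod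
  by (intro prod.cong) (auto simp: diff_divide_distrib)

lemma Lagrange_interpolation:
  assumes inj: "inj_on x {..<r}" and p: "degree p < r"
  shows "p = (\<Sum>j<r. smult (poly p (x j)) (Lagrange_poly x r j))"
proof (rule poly_eqI_degree[where A = "x ` {..<r}"])
  have "degree (Lagrange_poly x r j) \<le> r - 1" if "j < r" for j
  proof -
    have "degree (Lagrange_poly x r j) \<le> (\<Sum>k\<in>{..<r} - {j}. degree (smult (1 / (x j - x k)) [:- x k, 1:]))"
      unfolding Lagrange_poly_def by (rule order_trans[OF degree_prod_sum_le]) (simp_all add: comp_def del: smult_pCons)
    also have "\<dots> \<le> (\<Sum>k\<in>{..<r} - {j}. 1)"
      by (intro sum_mono) (auto intro: order_trans[OF degree_smult_le])
    also have "\<dots> = r - 1"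
      using that by simp
    finally show ?thesis .
  qed
  then have "degree (\<Sum>j<r. smult (poly p (x j)) (Lagrange_poly x r j)) \<le> r - 1"
    by (intro degree_sum_le) (auto intro: order_trans[OF degree_smult_le])
  then show "degree (\<Sum>j<r. smult (poly p (x j)) (Lagrange_poly x r j)) < card (x ` {..<r})"
    using p by (simp add: card_image[OF inj])
  show "degree p < card (x ` {..<r})"
    using p by (simp add: card_image[OF inj])
  fix t assume "t \<in> x ` {..<r}"
  then obtain i where i: "i < r" "t = x i" by auto
  have "poly (Lagrange_poly x r j) (x i) = (if j = i then 1 else 0)" if "j < r" for j
  proof (cases "j = i")
    case True
    have "x i - x k \<noteq> 0" if "k \<in> {..<r} - {i}" for k
      using inj that i by (auto simp: inj_on_def)
    then show ?thesis
      using True by (simp add: poly_Lagrange_poly)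
  next
    case False
    then show ?thesis
      using i by (auto simp: poly_Lagrange_poly intro!: prod_zero bexI[of _ i])
  qed
  then have "(\<Sum>j<r. poly p (x j) * poly (Lagrange_poly x r j) (x i)) = (\<Sum>j<r. if j = i then poly p (x j) else 0)"
    by (intro sum.cong) auto
  then show "poly p t = poly (\<Sum>j<r. smult (poly p (x j)) (Lagrange_poly x r j)) t"
    using i by (simp add: poly_sum)
qed

text \<open>The constant depends on \<open>r\<close> only: it is uniform over all node sets in the unit interval whose
spacing is at least \<open>1 / r\<close>, in particular over all translates of one node set.\<close>

lemma Lagrange_poly_Lipschitz:
  assumes x: "\<And>k. k < r \<Longrightarrow> x k \<in> {0..1}"
    and sep: "\<And>k. k < r \<Longrightarrow> k \<noteq> j \<Longrightarrow> 1 / real r \<le> \<bar>x j - x k\<bar>"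
    and "j < r" and s: "s \<in> {0..1}" and t: "t \<in> {0..1}"
  shows "\<bar>poly (Lagrange_poly x r j) s - poly (Lagrange_poly x r j) t\<bar> \<le> real r ^ r * \<bar>s - t\<bar>"
proof -
  let ?K = "{..<r} - {j}"
  define g where "g u k = (u - x k) / (real r * (x j - x k))" for u k
  have r: "real r > 0" using \<open>j < r\<close> by simp
  have eq: "poly (Lagrange_poly x r j) u = real r ^ (r - 1) * (\<Prod>k\<in>?K. g u k)" for u
  proof -
    have "poly (Lagrange_poly x r j) u = (\<Prod>k\<in>?K. real r * g u k)"
      unfolding poly_Lagrange_poly g_def using r by (intro prod.cong) auto
    then show ?thesis
      using \<open>j < r\<close> by (simp add: prod.distrib)
  qed
  have den: "1 \<le> \<bar>real r * (x j - x k)\<bar>" if "k \<in> ?K" for k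
    using sep[of k] that r by (auto simp: abs_mult pos_divide_le_eq mult.commute)
  have bound: "norm (g u k) \<le> 1" if "u \<in> {0..1}" "k \<in> ?K" for u k
  proof -
    have "\<bar>u - x k\<bar> \<le> 1" using x[of k] that by auto
    also note den[OF that(2)]
    finally show ?thesis unfolding g_def by (auto simp: abs_divide divide_le_eq_1)
  qed
  have "norm ((\<Prod>k\<in>?K. g s k) - (\<Prod>k\<in>?K. g t k)) \<le> (\<Sum>k\<in>?K. norm (g s k - g t k))"
    by (rule norm_prod_diff) (use bound s t in auto)
  also have "\<dots> \<le> (\<Sum>k\<in>?K. \<bar>s - t\<bar>)"
  proof (rule sum_mono)
    fix k assume k: "k \<in> ?K"
    have "g s k - g t k = (s - t) / (real r * (x j - x k))"
      by (simp add: g_def diff_divide_distrib)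
    then have "norm (g s k - g t k) = \<bar>s - t\<bar> / \<bar>real r * (x j - x k)\<bar>"
      by simp
    also have "\<dots> \<le> \<bar>s - t\<bar> / 1"
      using den[OF k] r by (intro divide_left_mono) (auto simp: abs_mult)
    finally show "norm (g s k - g t k) \<le> \<bar>s - t\<bar>" by simp
  qed
  also have "\<dots> \<le> real r * \<bar>s - t\<bar>"
    using \<open>j < r\<close> by (auto intro!: mult_right_mono)
  finally have "\<bar>(\<Prod>k\<in>?K. g s k) - (\<Prod>k\<in>?K. g t k)\<bar> \<le> real r * \<bar>s - t\<bar>" by simp
  then have "real r ^ (r - 1) * \<bar>(\<Prod>k\<in>?K. g s k) - (\<Prod>k\<in>?K. g t k)\<bar> \<le> real r ^ (r - 1) * (real r * \<bar>s - t\<bar>)"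
    by (intro mult_left_mono) auto
  also have "\<dots> = real r ^ r * \<bar>s - t\<bar>"
    using \<open>j < r\<close> by (cases r) auto
  finally show ?thesis
    unfolding eq right_diff_distrib[symmetric] abs_mult by simp
qed

lemma sum_nat_product:
  fixes f :: "nat \<Rightarrow> real"
  shows "(\<Sum>j<r. \<Sum>l<M. f (j * M + l)) = (\<Sum>i<r * M. f i)"
proof -
  have "(\<Sum>l<M. f (j * M + l)) = sum f {j * M..<j * M + M}" for j
    using sum.shift_bounds_nat_ivl[of f 0 "j * M" M] by (simp add: add.commute lessThan_atLeast0)
  then show ?thesis by (simp add: sum.nat_group)
qed

text \<open>Start from the Riemann sum over the grid \<open>i / N\<close>, where \<open>N = r M\<close>. Its error functional \<open>E\<close>,
restricted to polynomials of degree less than \<open>r\<close>, can be written as a combination of point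
evaluations at any \<open>r\<close> distinct nodes, by Lagrange interpolation. The grid splits into \<open>M\<close>
translates of the nodes \<open>j / r\<close>; distributing the correction evenly over these translates changes
each weight \<open>1 / N\<close> by \<open>E L / M\<close> for a Lagrange polynomial \<open>L\<close>. As \<open>\<bar>E L\<bar>\<close> is at most \<open>r ^ r / N\<close>, the choice \<open>M = r ^ r\<close> keeps all weights nonnegative.\<close>

lemma positive_quadrature_exists:
  assumes "r \<ge> 1"
  shows "\<exists>(I :: (nat \<times> nat) set) w x. finite I \<and> I \<noteq> {} \<and>
    (\<forall>i\<in>I. 0 \<le> w i \<and> x i \<in> {0..1}) \<and> (\<forall>k<r. (\<Sum>i\<in>I. w i * x i ^ k) = 1 / real (Suc k))"
proof -
  define M N where "M = r ^ r" and "N = r * M"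
  have "M > 0" "N > 0" using \<open>r \<ge> 1\<close> by (auto simp: M_def N_def)
  define y where "y l j = real (j * M + l) / real N" for l j
  define E where "E p = integral {0..1} (poly p) - (\<Sum>i<N. poly p (real i / real N)) / real N" for p :: "real poly"
  define L where "L l j = Lagrange_poly (y l) r j" for l j
  define w where "w = (\<lambda>(j, l). 1 / real N + E (L l j) / real M)"
  define x where "x = (\<lambda>(j, l). y l j)"
  have y01: "y l j \<in> {0..1}" if "j < r" "l < M" for l j
  proof -
    have "j * M + l < Suc j * M" using that by simp
    also have "\<dots> \<le> N" unfolding N_def using that by (intro mult_le_mono1) simp
    finally have "real (j * M + l) \<le> real N" by (simp only: of_nat_le_iff less_imp_le)
    then show ?thesis
      using \<open>N > 0\<close> by (simp only: y_def atLeastAtMost_iff) (simp add: divide_le_eq_1)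
  qed
  have ydiff: "y l j - y l k = (real j - real k) / real r" for l j k
    using \<open>M > 0\<close> \<open>r \<ge> 1\<close> by (simp add: y_def N_def field_simps)
  have inj: "inj_on (y l) {..<r}" for l
  proof (rule inj_onI)
    fix j k assume "y l j = y l k"
    then show "j = k" using ydiff[of l j k] \<open>r \<ge> 1\<close> by simp
  qed
  have int: "poly p integrable_on {0..1}" for p :: "real poly"
    by (intro integrable_continuous_real continuous_intros)
  have E_lin: "E (\<Sum>j<r. smult (a j) (q j)) = (\<Sum>j<r. a j * E (q j))" for a q
  proof -
    have "integral {0..1} (poly (\<Sum>j<r. smult (a j) (q j))) = (\<Sum>j<r. a j * integral {0..1} (poly (q j)))"
    proof -
      have "poly (\<Sum>j<r. smult (a j) (q j)) = (\<lambda>t. \<Sum>j<r. a j * poly (q j) t)"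
        by (auto simp: poly_sum)
      then show ?thesis
        using int by (simp add: integral_sum integrable_on_mult_right)
    qed
    moreover have "(\<Sum>i<N. poly (\<Sum>j<r. smult (a j) (q j)) (real i / real N)) =
        (\<Sum>j<r. a j * (\<Sum>i<N. poly (q j) (real i / real N)))"
      by (simp add: poly_sum sum_distrib_left) (rule sum.swap)
    ultimately show ?thesis
      by (simp add: E_def right_diff_distrib sum_subtractf sum_divide_distrib[of _ "{..<r}"])
  qed
  show ?thesis
  proof (rule exI[of _ "{..<r} \<times> {..<M}"], rule exI[of _ w], rule exI[of _ x], intro conjI ballI allI impI)
    show "finite ({..<r} \<times> {..<M})" "{..<r} \<times> {..<M} \<noteq> {}"
      using \<open>r \<ge> 1\<close> \<open>M > 0\<close> by (auto simp: lessThan_empty_iff)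
    show "x i \<in> {0..1}" if "i \<in> {..<r} \<times> {..<M}" for i
      using that y01 by (auto simp: x_def)
    show "0 \<le> w i" if i_in: "i \<in> {..<r} \<times> {..<M}" for i
    proof -
      obtain j l where i: "i = (j, l)" "j < r" "l < M" using i_in by auto
      have "\<bar>E (L l j)\<bar> \<le> real r ^ r / real N"
        unfolding E_def
      proof (rule Riemann_sum_error)
        show "\<bar>poly (L l j) s - poly (L l j) t\<bar> \<le> real r ^ r * \<bar>s - t\<bar>" if "s \<in> {0..1}" "t \<in> {0..1}" for s t
          unfolding L_def
        proof (rule Lagrange_poly_Lipschitz)
          show "1 / real r \<le> \<bar>y l j - y l k\<bar>" if "k \<noteq> j" for k
          proof -
            have "1 \<le> \<bar>real j - real k\<bar>" using that by linarith
            then show ?thesis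
              unfolding ydiff by (simp add: abs_divide divide_right_mono)
          qed
        qed (use y01 i that in auto)
      qed (use \<open>N > 0\<close> in \<open>auto intro!: continuous_intros\<close>)
      also have "\<dots> = real M / real N"
        by (simp add: M_def)
      finally have "- (1 / real N) \<le> E (L l j) / real M"
        using \<open>M > 0\<close> by (simp add: abs_le_iff field_simps)
      then show ?thesis by (simp add: w_def i)
    qed
    show "(\<Sum>i\<in>{..<r} \<times> {..<M}. w i * x i ^ k) = 1 / real (Suc k)" if "k < r" for k
    proof -
      define p :: "real poly" where "p = monom 1 k"
      have p: "poly p t = t ^ k" for t by (simp add: p_def poly_monom)
      have "degree p < r" using that by (simp add: p_def degree_monom_eq)
      \<comment> \<open>Each translate of the nodes reproduces the error of the Riemann sum on monomials.\<close>
      have Ep: "(\<Sum>j<r. E (L l j) * y l j ^ k) = E p" for l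
      proof -
        have "E p = E (\<Sum>j<r. smult (poly p (y l j)) (L l j))"
          using Lagrange_interpolation[OF inj \<open>degree p < r\<close>, of l] by (simp add: L_def)
        then show ?thesis by (simp add: E_lin p mult.commute)
      qed
      have "(\<Sum>i\<in>{..<r} \<times> {..<M}. w i * x i ^ k) = (\<Sum>j<r. \<Sum>l<M. (1 / real N + E (L l j) / real M) * y l j ^ k)"
        unfolding sum.cartesian_product by (intro sum.cong) (auto simp: w_def x_def)
      also have "\<dots> = (\<Sum>j<r. \<Sum>l<M. y l j ^ k) / real N + (\<Sum>j<r. \<Sum>l<M. E (L l j) * y l j ^ k) / real M"
        by (simp add: distrib_right sum.distrib sum_divide_distrib)
      also have "(\<Sum>j<r. \<Sum>l<M. E (L l j) * y l j ^ k) = (\<Sum>l<M. E p)"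
        by (subst sum.swap) (simp add: Ep)
      also have "(\<Sum>l<M. E p) / real M = E p"
        using \<open>M > 0\<close> by simp
      also have "(\<Sum>j<r. \<Sum>l<M. y l j ^ k) = (\<Sum>i<N. (real i / real N) ^ k)"
        unfolding y_def N_def by (rule sum_nat_product)
      also have "(\<Sum>i<N. (real i / real N) ^ k) / real N + E p = integral {0..1} (poly p)"
        by (simp add: E_def p)
      also have "\<dots> = 1 / real (Suc k)"
      proof -
        have "(poly p has_integral (1 ^ Suc k / real (Suc k) - 0 ^ Suc k / real (Suc k))) {0..1}"
        proof (rule fundamental_theorem_of_calculus)
          fix t :: real
          have "((\<lambda>t. t ^ Suc k / real (Suc k)) has_real_derivative poly p t) (at t within {0..1})"
            unfolding p by (auto intro!: derivative_eq_intros simp del: power_Suc)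
          then show "((\<lambda>t. t ^ Suc k / real (Suc k)) has_vector_derivative poly p t) (at t within {0..1})"
            by (simp only: has_real_derivative_iff_has_vector_derivative)
        qed simp
        then show ?thesis by (simp add: integral_unique)
      qed
      finally show ?thesis .
    qed
  qed
qed

text \<open>The rule, transported to the cell, integrates the Taylor polynomial \<open>T\<close> at the left end point exactly. The
remainder is at most \<open>h ^ r\<close>, and it is counted once for the integral and once for the rule, whose
weights are nonnegative and sum to one.\<close>

lemma cell_quadrature_error:
  fixes \<phi> :: "nat \<Rightarrow> real \<Rightarrow> real"
  assumes "r \<ge> 1" and I: "finite I" "\<And>i. i \<in> I \<Longrightarrow> 0 \<le> w i" "\<And>i. i \<in> I \<Longrightarrow> x i \<in> {0..1}"
    and moments: "\<And>k. k < r \<Longrightarrow> (\<Sum>i\<in>I. w i * x i ^ k) = 1 / real (Suc k)"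
    and der: "\<And>k t. k < r \<Longrightarrow> t \<in> {0..1} \<Longrightarrow>
      (\<phi> k has_real_derivative \<phi> (Suc k) t) (at t within {0..1})"
    and bound: "\<And>t. t \<in> {0..1} \<Longrightarrow> \<bar>\<phi> r t\<bar> \<le> 1"
    and "0 \<le> a" "0 \<le> h" "a + h \<le> 1"
  shows "\<bar>integral {a..a + h} (\<phi> 0) - h * (\<Sum>i\<in>I. w i * \<phi> 0 (a + h * x i))\<bar> \<le> 2 * h * h ^ r"
proof -
  define T where "T t = (\<Sum>k<r. \<phi> k a / fact k * (t - a) ^ k)" for t
  define Q where "Q = (\<Sum>k<r. \<phi> k a / fact k * (h ^ Suc k / real (Suc k)))"
  have cont: "continuous_on {0..1} (\<phi> 0)"
    by (rule DERIV_continuous_on[where D = "\<phi> (Suc 0)"]) (use der[of 0] \<open>r \<ge> 1\<close> in auto)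
  have Taylor: "\<bar>\<phi> 0 t - T t\<bar> \<le> h ^ r" if t: "t \<in> {a..a + h}" for t
  proof -
    have "norm (\<phi> 0 t - (\<Sum>k\<le>r - 1. \<phi> k a * (t - a) ^ k / fact k)) \<le> 1 * norm (t - a) ^ Suc (r - 1) / fact (r - 1)"
    proof (rule field_Taylor[where S = "{0..1}"])
      show "(\<phi> k has_real_derivative \<phi> (Suc k) s) (at s within {0..1})" if "s \<in> {0..1}" "k \<le> r - 1" for k s
        using der[of k s] that \<open>r \<ge> 1\<close> by auto
      show "norm (\<phi> (Suc (r - 1)) s) \<le> 1" if "s \<in> {0..1}" for s
        using bound[OF that] \<open>r \<ge> 1\<close> by simp
    qed (use assms t in auto)
    also have "\<dots> \<le> norm (t - a) ^ r"
      using \<open>r \<ge> 1\<close> fact_ge_1[of "r - 1", where ?'a = real] by (simp add: divide_le_eq mult_le_cancel_left1)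
    also have "\<dots> \<le> h ^ r"
      using t by (intro power_mono) auto
    also have "{..r - 1} = {..<r}" using \<open>r \<ge> 1\<close> by auto
    finally show ?thesis by (simp add: T_def)
  qed
  have int_T: "(T has_integral Q) {a..a + h}"
  proof -
    define P where "P t = (\<Sum>k<r. \<phi> k a / fact k * ((t - a) ^ Suc k / real (Suc k)))" for t
    have "(T has_integral (P (a + h) - P a)) {a..a + h}"
    proof (rule fundamental_theorem_of_calculus)
      fix t
      have "(P has_real_derivative T t) (at t within {a..a + h})"
        unfolding P_def T_def
        by (auto intro!: derivative_eq_intros sum.cong simp del: power_Suc)
      then show "(P has_vector_derivative T t) (at t within {a..a + h})"
        by (simp only: has_real_derivative_iff_has_vector_derivative)
    qed (use \<open>0 \<le> h\<close> in simp)
    then show ?thesis by (simp add: P_def Q_def)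
  qed
  have sum_T: "h * (\<Sum>i\<in>I. w i * T (a + h * x i)) = Q"
  proof -
    have "h * (\<Sum>i\<in>I. w i * T (a + h * x i)) =
        (\<Sum>k<r. \<Sum>i\<in>I. \<phi> k a / fact k * h ^ Suc k * (w i * x i ^ k))"
      unfolding T_def by (simp add: sum_distrib_left power_mult_distrib mult_ac) (rule sum.swap)
    also have "\<dots> = Q"
      unfolding Q_def sum_distrib_left[symmetric] by (intro sum.cong) (auto simp: moments)
    finally show ?thesis .
  qed
  have w1: "(\<Sum>i\<in>I. w i) = 1"
    using moments[of 0] \<open>r \<ge> 1\<close> by simp
  have intf: "\<phi> 0 integrable_on {a..a + h}"
    by (rule integrable_continuous_real, rule continuous_on_subset[OF cont]) (use assms in auto)
  have "\<bar>integral {a..a + h} (\<phi> 0) - Q\<bar> \<le> h ^ r * h"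
  proof -
    have "integral {a..a + h} (\<lambda>t. \<phi> 0 t - T t) = integral {a..a + h} (\<phi> 0) - Q"
      using int_T intf by (subst integral_diff) (auto simp: integral_unique)
    moreover have "norm (integral (cbox a (a + h)) (\<lambda>t. \<phi> 0 t - T t)) \<le> h ^ r * measure lborel (cbox a (a + h))"
      by (rule integrable_bound) (use \<open>0 \<le> h\<close> intf int_T Taylor in \<open>auto intro!: integrable_diff\<close>)
    ultimately show ?thesis using \<open>0 \<le> h\<close> by simp
  qed
  moreover have "\<bar>Q - h * (\<Sum>i\<in>I. w i * \<phi> 0 (a + h * x i))\<bar> \<le> h * h ^ r"
  proof -
    have "\<bar>\<Sum>i\<in>I. w i * (T (a + h * x i) - \<phi> 0 (a + h * x i))\<bar> \<le> (\<Sum>i\<in>I. w i * h ^ r)"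
    proof (rule order_trans[OF sum_abs sum_mono])
      fix i assume i: "i \<in> I"
      then have "h * x i \<le> h * 1" "0 \<le> h * x i"
        using I(3)[OF i] \<open>0 \<le> h\<close> by (auto simp: mult_left_le)
      then have "\<bar>T (a + h * x i) - \<phi> 0 (a + h * x i)\<bar> \<le> h ^ r"
        using Taylor[of "a + h * x i"] by (simp add: abs_minus_commute)
      then show "\<bar>w i * (T (a + h * x i) - \<phi> 0 (a + h * x i))\<bar> \<le> w i * h ^ r"
        using I(2)[OF i] by (simp add: abs_mult mult_left_mono)
    qed
    also have "\<dots> = h ^ r"
      using w1 by (simp add: sum_distrib_right[symmetric])
    finally have "h * \<bar>\<Sum>i\<in>I. w i * (T (a + h * x i) - \<phi> 0 (a + h * x i))\<bar> \<le> h * h ^ r"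
      using \<open>0 \<le> h\<close> by (rule mult_left_mono)
    moreover have "Q - h * (\<Sum>i\<in>I. w i * \<phi> 0 (a + h * x i)) =
        h * (\<Sum>i\<in>I. w i * (T (a + h * x i) - \<phi> 0 (a + h * x i)))"
      unfolding sum_T[symmetric] by (simp add: right_diff_distrib sum_subtractf)
    ultimately show ?thesis using \<open>0 \<le> h\<close> by (simp add: abs_mult)
  qed
  ultimately show ?thesis by (simp add: mult.commute[of "h ^ r"])
qed

text \<open>A quadrature rule with nonnegative weights of sum one becomes a probability mass function; several
nodes may coincide.\<close>

lemma finite_support_pmf_exists:
  fixes W node :: "'a \<Rightarrow> real"
  assumes J: "finite J" and "\<And>j. j \<in> J \<Longrightarrow> 0 \<le> W j" and W1: "(\<Sum>j\<in>J. W j) = 1"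
  shows "\<exists>p :: real pmf. set_pmf p \<subseteq> node ` J \<and>
    (\<forall>g :: real \<Rightarrow> real. measure_pmf.expectation p g = (\<Sum>j\<in>J. W j * g (node j)))"
proof -
  define W' where "W' j = (if j \<in> J then W j else 0)" for j
  have W'_nonneg: "0 \<le> W' j" for j
    using assms by (simp add: W'_def)
  have "(\<integral>\<^sup>+j. ennreal (W' j) \<partial>count_space UNIV) = (\<Sum>j\<in>J. ennreal (W' j))"
    by (rule nn_integral_count_space'[OF J]) (auto simp: W'_def)
  also have "\<dots> = ennreal (\<Sum>j\<in>J. W' j)"
    using W'_nonneg by (intro sum_ennreal)
  also have "(\<Sum>j\<in>J. W' j) = 1"
    using W1 by (simp add: W'_def)
  finally have pmf: "pmf (embed_pmf W') j = W' j" for j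
    by (intro pmf_embed_pmf W'_nonneg) simp
  have set: "set_pmf (embed_pmf W') \<subseteq> J"
    by (auto simp: set_pmf_eq pmf W'_def split: if_splits)
  show ?thesis
  proof (intro exI conjI allI)
    show "set_pmf (map_pmf node (embed_pmf W')) \<subseteq> node ` J"
      using set by auto
    show "measure_pmf.expectation (map_pmf node (embed_pmf W')) g = (\<Sum>j\<in>J. W j * g (node j))" for g
      unfolding integral_map_pmf using set
      by (subst integral_measure_pmf[OF J]) (auto intro!: sum.cong simp: pmf W'_def)
  qed
qed

text \<open>The sequence \<open>\<phi>\<close> lists a function and its derivatives, one-sided at the end points of the interval.\<close>

definition quadrature_error_le :: "nat \<Rightarrow> real \<Rightarrow> real pmf \<Rightarrow> bool" where
  "quadrature_error_le r e p \<longleftrightarrow>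
     (\<forall>\<phi>. (\<forall>k<r. \<forall>t\<in>{0..1}. (\<phi> k has_real_derivative \<phi> (Suc k) t) (at t within {0..1})) \<longrightarrow>
        (\<forall>t\<in>{0..1}. \<bar>\<phi> r t\<bar> \<le> 1) \<longrightarrow>
        \<bar>integral {0..1} (\<phi> 0) - measure_pmf.expectation p (\<phi> 0)\<bar> \<le> e)"

text \<open>Each of the \<open>m\<close> cells has length \<open>h = 1 / m\<close> and contributes at most \<open>2 h * h ^ r\<close>.\<close>

lemma composite_quadrature_exists:
  assumes "r \<ge> 1"
  shows "\<exists>N\<ge>1. \<forall>m\<ge>1. \<exists>p. finite (set_pmf p) \<and> card (set_pmf p) \<le> N * m \<and> set_pmf p \<subseteq> {0..1} \<and>
    quadrature_error_le r (2 / real m ^ r) p"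
proof -
  from positive_quadrature_exists[OF assms] obtain I :: "(nat \<times> nat) set" and w x
    where "finite I" "I \<noteq> {}" "\<forall>i\<in>I. 0 \<le> w i \<and> x i \<in> {0..1}"
      and "\<forall>k<r. (\<Sum>i\<in>I. w i * x i ^ k) = 1 / real (Suc k)"
    by (elim exE conjE)
  then have I: "finite I" "I \<noteq> {}" "\<And>i. i \<in> I \<Longrightarrow> 0 \<le> w i" "\<And>i. i \<in> I \<Longrightarrow> x i \<in> {0..1}"
    and moments: "\<And>k. k < r \<Longrightarrow> (\<Sum>i\<in>I. w i * x i ^ k) = 1 / real (Suc k)"
    by simp_all
  show ?thesis
  proof (intro exI[of _ "card I"] conjI allI impI)
    show "card I \<ge> 1" using I by (simp add: Suc_le_eq card_gt_0_iff)
    fix m :: nat assume "m \<ge> 1"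
    define J where "J = {..<m} \<times> I"
    define W where "W j = w (snd j) / real m" for j :: "nat \<times> nat \<times> nat"
    define node where "node j = real (fst j) / real m + 1 / real m * x (snd j)" for j :: "nat \<times> nat \<times> nat"
    have "finite J" using I by (simp add: J_def)
    have W0: "0 \<le> W j" if "j \<in> J" for j
      using that I by (auto simp: J_def W_def)
    have sumJ: "(\<Sum>j\<in>J. W j * g (node j)) =
        (\<Sum>c<m. 1 / real m * (\<Sum>i\<in>I. w i * g (real c / real m + 1 / real m * x i)))" for g :: "real \<Rightarrow> real"
      unfolding J_def sum_distrib_left sum.cartesian_product
      by (intro sum.cong) (auto simp: W_def node_def)
    have "(\<Sum>i\<in>I. w i) = 1" using moments[of 0] assms by simp
    then have W1: "(\<Sum>j\<in>J. W j) = 1"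
      using sumJ[of "\<lambda>_. 1"] \<open>m \<ge> 1\<close> by simp
    have "\<exists>p :: real pmf. set_pmf p \<subseteq> node ` J \<and>
        (\<forall>g :: real \<Rightarrow> real. measure_pmf.expectation p g = (\<Sum>j\<in>J. W j * g (node j)))"
      by (rule finite_support_pmf_exists[OF \<open>finite J\<close> W0 W1])
    then obtain p :: "real pmf" where set: "set_pmf p \<subseteq> node ` J"
      and E: "\<forall>g :: real \<Rightarrow> real. measure_pmf.expectation p g = (\<Sum>j\<in>J. W j * g (node j))"
      by (elim exE conjE)
    show "\<exists>p :: real pmf. finite (set_pmf p) \<and> card (set_pmf p) \<le> card I * m \<and> set_pmf p \<subseteq> {0..1} \<and>
      quadrature_error_le r (2 / real m ^ r) p"
      unfolding quadrature_error_le_def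
    proof (intro exI[of _ p] conjI allI impI)
      show "finite (set_pmf p)"
        using set \<open>finite J\<close> finite_subset by blast
      have "card (set_pmf p) \<le> card (node ` J)"
        using set \<open>finite J\<close> by (intro card_mono) auto
      also have "\<dots> \<le> card J" by (rule card_image_le[OF \<open>finite J\<close>])
      also have "\<dots> = card I * m" by (simp add: J_def card_cartesian_product)
      finally show "card (set_pmf p) \<le> card I * m" .
      have "node j \<in> {0..1}" if "j \<in> J" for j
      proof -
        have "fst j < m" and x: "x (snd j) \<in> {0..1}" using that I(4) by (auto simp: J_def)
        have "node j = (real (fst j) + x (snd j)) / real m"
          by (simp add: node_def add_divide_distrib)
        moreover have "0 \<le> real (fst j) + x (snd j)" "real (fst j) + x (snd j) \<le> real m"
          using \<open>fst j < m\<close> x by auto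
        ultimately show ?thesis
          using \<open>m \<ge> 1\<close> by (simp add: divide_le_eq_1)
      qed
      then show "set_pmf p \<subseteq> {0..1}" using set by blast
      fix \<phi> :: "nat \<Rightarrow> real \<Rightarrow> real"
      assume der: "\<forall>k<r. \<forall>t\<in>{0..1}. (\<phi> k has_real_derivative \<phi> (Suc k) t) (at t within {0..1})"
        and bound: "\<forall>t\<in>{0..1}. \<bar>\<phi> r t\<bar> \<le> 1"
      let ?h = "1 / real m"
      have "continuous_on {0..1} (\<phi> 0)"
        by (rule DERIV_continuous_on[where D = "\<phi> (Suc 0)"]) (use der assms in auto)
      then have int: "\<phi> 0 integrable_on {0..1}" by (rule integrable_continuous_real)
      have cell: "\<bar>integral {real c / real m..real (Suc c) / real m} (\<phi> 0) -
          ?h * (\<Sum>i\<in>I. w i * \<phi> 0 (real c / real m + ?h * x i))\<bar> \<le> 2 * ?h * ?h ^ r" if "c < m" for c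
      proof -
        have "real (Suc c) / real m \<le> 1" using that by simp
        moreover have "real (Suc c) / real m = real c / real m + ?h"
          by (simp add: add_divide_distrib)
        ultimately show ?thesis
          using cell_quadrature_error[OF assms I(1,3,4) moments, of \<phi> "real c / real m" ?h] der bound
          by simp
      qed
      have "\<bar>integral {0..1} (\<phi> 0) - measure_pmf.expectation p (\<phi> 0)\<bar> =
          \<bar>\<Sum>c<m. integral {real c / real m..real (Suc c) / real m} (\<phi> 0) -
          ?h * (\<Sum>i\<in>I. w i * \<phi> 0 (real c / real m + ?h * x i))\<bar>"
        using integral_unit_interval_cells[OF int, of m] \<open>m \<ge> 1\<close> unfolding E[rule_format] sumJ by (simp add: sum_subtractf)
      also have "\<dots> \<le> (\<Sum>c<m. 2 * ?h * ?h ^ r)"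
        by (intro order_trans[OF sum_abs] sum_mono cell) auto
      also have "\<dots> = 2 / real m ^ r"
        using \<open>m \<ge> 1\<close> by (simp add: power_divide)
      finally show "\<bar>integral {0..1} (\<phi> 0) - measure_pmf.expectation p (\<phi> 0)\<bar> \<le> 2 / real m ^ r" .
    qed
  qed
qed

section \<open>Product rules\<close>

text \<open>The measures \<open>H k\<close> interpolate between the two products: the first \<open>k\<close> factors are already
replaced. Two neighbours differ in one factor, and integrating the one-dimensional difference over
the remaining coordinates, a probability space, does not enlarge it.\<close>

lemma hybrid_product_integral:
  fixes M0 M1 :: "real measure" and g :: "point \<Rightarrow> real"
  assumes M0: "prob_space M0" "sets M0 = sets borel" and M1: "prob_space M1" "sets M1 = sets borel"
    and g: "continuous_on UNIV g" and B: "\<And>x. \<bar>g x\<bar> \<le> B"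
    and e: "\<And>x i. i < d \<Longrightarrow> \<bar>(\<integral>t. g (x(i := t)) \<partial>M0) - (\<integral>t. g (x(i := t)) \<partial>M1)\<bar> \<le> e"
  shows "\<bar>(\<integral>x. g x \<partial>Pi\<^sub>M {..<d} (\<lambda>_. M0)) - (\<integral>x. g x \<partial>Pi\<^sub>M {..<d} (\<lambda>_. M1))\<bar> \<le> real d * e"
proof -
  define H where "H k i = (if i < k then M1 else M0)" for k i :: nat
  have prob: "prob_space (H k i)" and sets: "sets (H k i) = sets borel" for k i
    using M0 M1 by (auto simp: H_def)
  let ?I = "\<lambda>k. \<integral>x. g x \<partial>Pi\<^sub>M {..<d} (H k)"
  have step: "\<bar>?I k - ?I (Suc k)\<bar> \<le> e" if "k < d" for k
  proof -
    define J where "J = {..<d} - {k}"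
    have J: "finite J" "k \<notin> J" "insert k J = {..<d}" using that by (auto simp: J_def)
    interpret PJ: prob_space "Pi\<^sub>M J (H k)"
      by (intro prob_space_PiM prob)
    define a where "a M x = (\<integral>t. g (x(k := t)) \<partial>M)" for M :: "real measure" and x
    have eq: "?I k' = (\<integral>x. a (H k' k) x \<partial>Pi\<^sub>M J (H k'))" for k'
    proof -
      interpret product_sigma_finite "H k'"
        unfolding product_sigma_finite_def using prob by (auto intro: prob_space_imp_sigma_finite)
      interpret P: prob_space "Pi\<^sub>M {..<d} (H k')"
        by (intro prob_space_PiM prob)
      have "integrable (Pi\<^sub>M {..<d} (H k')) g"
        using B by (intro P.integrable_const_bound[where B = B] borel_measurable_PiM_continuous g sets) auto
      then show ?thesis
        unfolding J(3)[symmetric] a_def by (intro product_integral_insert J)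
    qed
    have same: "Pi\<^sub>M J (H (Suc k)) = Pi\<^sub>M J (H k)"
      by (rule PiM_cong) (auto simp: H_def J_def)
    have int: "integrable (Pi\<^sub>M J (H k)) (a (H k' k))" for k'
    proof (rule PJ.integrable_const_bound[where B = B])
      interpret M: prob_space "H k' k" by (rule prob)
      have "(\<lambda>(x, t). x(k := t)) \<in> measurable (Pi\<^sub>M J (H k) \<Otimes>\<^sub>M H k k) (Pi\<^sub>M {..<d} (H k))"
        using measurable_add_dim[of k J "H k"] J(3) by simp
      from measurable_compose[OF this borel_measurable_PiM_continuous[OF g sets]]
      have "(\<lambda>(x, t). g (x(k := t))) \<in> borel_measurable (Pi\<^sub>M J (H k) \<Otimes>\<^sub>M H k k)"
        by (simp add: case_prod_unfold)
      also have "borel_measurable (Pi\<^sub>M J (H k) \<Otimes>\<^sub>M H k k) = borel_measurable (Pi\<^sub>M J (H k) \<Otimes>\<^sub>M H k' k)"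
        by (intro measurable_cong_sets sets_pair_measure_cong) (auto simp: sets)
      finally show "a (H k' k) \<in> borel_measurable (Pi\<^sub>M J (H k))"
        unfolding a_def[abs_def] by (rule M.borel_measurable_lebesgue_integral)
      have "\<bar>a (H k' k) x\<bar> \<le> B" for x
      proof -
        have "integrable (H k' k) (\<lambda>t. g (x(k := t)))"
        proof (rule M.integrable_const_bound[where B = B])
          have "continuous_on UNIV (\<lambda>t. g (x(k := t)))"
            by (rule continuous_on_section[OF g]) (intro continuous_intros)
          from borel_measurable_continuous_onI[OF this]
          show "(\<lambda>t. g (x(k := t))) \<in> borel_measurable (H k' k)"
            using measurable_cong_sets[OF sets refl] by blast
        qed (use B in auto)
        moreover have "- B \<le> g y" "g y \<le> B" for y
          using B[of y] by auto
        ultimately have "a (H k' k) x \<le> B" "- B \<le> a (H k' k) x"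
          unfolding a_def by (auto intro!: M.integral_le_const M.integral_ge_const)
        then show ?thesis by auto
      qed
      then show "AE x in Pi\<^sub>M J (H k). norm (a (H k' k) x) \<le> B" by simp
    qed
    have "?I k - ?I (Suc k) = (\<integral>x. a (H k k) x - a (H (Suc k) k) x \<partial>Pi\<^sub>M J (H k))"
      unfolding eq same by (rule Bochner_Integration.integral_diff[symmetric]) (rule int)+
    moreover have close: "\<bar>a (H k k) x - a (H (Suc k) k) x\<bar> \<le> e" for x
      using e[OF that, of x] by (simp add: a_def H_def)
    have "- e \<le> a (H k k) x - a (H (Suc k) k) x" "a (H k k) x - a (H (Suc k) k) x \<le> e" for x
      using close[of x] by linarith+
    then have "- e \<le> (\<integral>x. a (H k k) x - a (H (Suc k) k) x \<partial>Pi\<^sub>M J (H k))"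
      "(\<integral>x. a (H k k) x - a (H (Suc k) k) x \<partial>Pi\<^sub>M J (H k)) \<le> e"
      by (intro PJ.integral_ge_const PJ.integral_le_const Bochner_Integration.integrable_diff int; simp)+
    ultimately show ?thesis by auto
  qed
  have "\<bar>?I 0 - ?I k\<bar> \<le> real k * e" if "k \<le> d" for k
    using that
  proof (induction k)
    case (Suc k)
    then show ?case using step[of k] by (auto simp: algebra_simps)
  qed simp
  from this[of d] have "\<bar>?I 0 - ?I d\<bar> \<le> real d * e" by simp
  moreover have "Pi\<^sub>M {..<d} (H 0) = Pi\<^sub>M {..<d} (\<lambda>_. M0)" "Pi\<^sub>M {..<d} (H d) = Pi\<^sub>M {..<d} (\<lambda>_. M1)"
    by (auto intro!: PiM_cong simp: H_def)
  ultimately show ?thesis by simp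
qed

definition uniform01 :: "real measure" where
  "uniform01 = density lborel (\<lambda>t. ennreal (indicator {0..1} t))"

lemma sets_uniform01: "sets uniform01 = sets borel"
  by (simp add: uniform01_def)

lemma emeasure_uniform01:
  assumes "A \<in> sets borel"
  shows "emeasure uniform01 A = emeasure lborel ({0..1} \<inter> A)"
proof -
  have "emeasure uniform01 A = (\<integral>\<^sup>+t. ennreal (indicator {0..1} t) * indicator A t \<partial>lborel)"
    unfolding uniform01_def using assms by (intro emeasure_density) auto
  also have "\<dots> = (\<integral>\<^sup>+t. indicator ({0..1} \<inter> A) t \<partial>lborel)"
    by (intro nn_integral_cong) (auto simp: indicator_def)
  also have "\<dots> = emeasure lborel ({0..1} \<inter> A)"
    using assms by (intro nn_integral_indicator) auto
  finally show ?thesis .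
qed

lemma prob_space_uniform01: "prob_space uniform01"
proof
  have "space uniform01 = UNIV" by (simp add: uniform01_def)
  then show "emeasure uniform01 (space uniform01) = 1"
    by (simp add: emeasure_uniform01)
qed

lemma integral_uniform01:
  fixes f :: "real \<Rightarrow> real"
  assumes f: "continuous_on UNIV f"
  shows "(\<integral>t. f t \<partial>uniform01) = integral {0..1} f"
proof -
  have "(\<integral>t. f t \<partial>uniform01) = (\<integral>t. indicator {0..1} t *\<^sub>R f t \<partial>lborel)"
    unfolding uniform01_def
    using borel_measurable_continuous_onI[OF f] by (intro integral_density) auto
  also have "\<dots> = integral {0..1} f"
    using set_borel_integral_eq_integral(2)[OF borel_integrable_atLeastAtMost'[of 0 1 f]] continuous_on_subset[OF f]
    by (simp add: set_lebesgue_integral_def)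
  finally show ?thesis .
qed

lemma unit_cube_sets: "unit_cube d \<in> sets (rn_lborel d)"
  using emeasure_unit_cube[of d] emeasure_notin_sets by fastforce

text \<open>The uniform distribution on the cube is a product of one-dimensional ones, because a product measure
is determined by its values on boxes.\<close>

lemma integral_on_unit_cube:
  assumes f: "f \<in> borel_measurable (rn_lborel d)"
  shows "integral_on d (unit_cube d) f = (\<integral>x. f x \<partial>Pi\<^sub>M {..<d} (\<lambda>_. uniform01))"
proof -
  let ?P = "density (rn_lborel d) (\<lambda>x. ennreal (indicator (unit_cube d) x))"
  interpret L: product_sigma_finite "\<lambda>_::nat. lborel :: real measure" by standard
  interpret U: product_sigma_finite "\<lambda>_::nat. uniform01"
    unfolding product_sigma_finite_def using prob_space_uniform01 by (auto intro: prob_space_imp_sigma_finite)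
  have "?P = Pi\<^sub>M {..<d} (\<lambda>_. uniform01)"
  proof (rule U.PiM_eqI)
    show "sets ?P = sets (Pi\<^sub>M {..<d} (\<lambda>_. uniform01))"
      by (simp add: rn_lborel_def) (intro sets_PiM_cong; simp add: sets_uniform01)
    fix A :: "nat \<Rightarrow> real set" assume "\<And>i. i \<in> {..<d} \<Longrightarrow> A i \<in> sets uniform01"
    then have A: "A i \<in> sets borel" if "i < d" for i
      using that by (simp add: sets_uniform01)
    have PA: "Pi\<^sub>E {..<d} A \<in> sets (rn_lborel d)"
      unfolding rn_lborel_def using A by (intro sets_PiM_I_finite) auto
    have "emeasure ?P (Pi\<^sub>E {..<d} A) =
        (\<integral>\<^sup>+x. ennreal (indicator (unit_cube d) x) * indicator (Pi\<^sub>E {..<d} A) x \<partial>rn_lborel d)"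
      using PA unit_cube_sets by (intro emeasure_density) auto
    also have "\<dots> = (\<integral>\<^sup>+x. indicator (unit_cube d \<inter> Pi\<^sub>E {..<d} A) x \<partial>rn_lborel d)"
      by (intro nn_integral_cong) (auto simp: indicator_def)
    also have "\<dots> = emeasure (rn_lborel d) (unit_cube d \<inter> Pi\<^sub>E {..<d} A)"
      using PA unit_cube_sets by (intro nn_integral_indicator) auto
    also have "unit_cube d \<inter> Pi\<^sub>E {..<d} A = Pi\<^sub>E {..<d} (\<lambda>i. {0..1} \<inter> A i)"
      by (auto simp: unit_cube_def PiE_iff)
    also have "emeasure (rn_lborel d) \<dots> = (\<Prod>i<d. emeasure lborel ({0..1} \<inter> A i))"
      unfolding rn_lborel_def using A by (intro L.emeasure_PiM) auto
    also have "\<dots> = (\<Prod>i<d. emeasure uniform01 (A i))"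
      using A by (intro prod.cong) (auto simp: emeasure_uniform01)
    finally show "emeasure ?P (Pi\<^sub>E {..<d} A) = (\<Prod>i<d. emeasure uniform01 (A i))" .
  qed simp
  moreover have "(\<integral>x. f x \<partial>?P) = (\<integral>x. indicator (unit_cube d) x *\<^sub>R f x \<partial>rn_lborel d)"
    using f unit_cube_sets by (intro integral_density) auto
  ultimately show ?thesis
    by (simp add: integral_on_def set_lebesgue_integral_def)
qed

text \<open>Composition with the retraction onto the cube extends a function that is continuous on the cube to
a continuous function on the whole space, which settles measurability.\<close>

definition clamp_cube :: "nat \<Rightarrow> point \<Rightarrow> point" where
  "clamp_cube d x = (\<lambda>i. if i < d then max 0 (min 1 (x i)) else undefined)"

lemma clamp_cube_in: "clamp_cube d x \<in> unit_cube d"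
  unfolding unit_cube_def by (rule PiE_I) (auto simp: clamp_cube_def)

lemma clamp_cube_id: "x \<in> unit_cube d \<Longrightarrow> clamp_cube d x = x"
  by (rule ext) (auto simp: clamp_cube_def unit_cube_def PiE_iff extensional_def)

lemma clamp_cube_upd: "i < d \<Longrightarrow> t \<in> {0..1} \<Longrightarrow> clamp_cube d (x(i := t)) = (clamp_cube d x)(i := t)"
  by (rule ext) (auto simp: clamp_cube_def)

lemma continuous_on_clamp:
  assumes "continuous_map (subtopology (rn_topology d) (unit_cube d)) euclideanreal f"
  shows "continuous_on UNIV (\<lambda>x. f (clamp_cube d x))"
proof -
  have "continuous_map euclidean (rn_topology d) (clamp_cube d)"
    unfolding rn_topology_def continuous_map_componentwise
  proof (intro conjI ballI)
    show "clamp_cube d ` topspace euclidean \<subseteq> extensional {..<d}"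
      by (auto simp: extensional_def) (simp add: clamp_cube_def)
    fix k assume "k \<in> {..<d}"
    then have "(\<lambda>x. clamp_cube d x k) = (\<lambda>x. max 0 (min 1 (x k)))"
      by (auto simp: clamp_cube_def)
    moreover have "continuous_on UNIV (\<lambda>x :: point. max 0 (min 1 (x k)))"
      by (intro continuous_on_max continuous_on_min continuous_on_const continuous_on_coord)
    ultimately show "continuous_map euclidean euclideanreal (\<lambda>x. clamp_cube d x k)"
      by simp
  qed
  then have "continuous_map euclidean (subtopology (rn_topology d) (unit_cube d)) (clamp_cube d)"
    using clamp_cube_in by (auto simp: continuous_map_in_subtopology)
  from continuous_map_compose[OF this assms] show ?thesis
    by (simp add: comp_def)
qed

lemma cont_diff_iterated_partial:
  assumes "cont_diff d D r f" "i < d" "k \<le> r"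
  shows "cont_diff d D (r - k) ((partial D i ^^ k) f)"
  using assms(3)
proof (induction k)
  case (Suc k)
  then have "cont_diff d D (Suc (r - Suc k)) ((partial D i ^^ k) f)"
    by (simp add: Suc_diff_Suc)
  then show ?case using \<open>i < d\<close> by simp
qed (use assms in simp)

lemma cont_diff_continuous: "cont_diff d D r f \<Longrightarrow> continuous_map (subtopology (rn_topology d) D) euclideanreal f"
  by (cases r) auto

lemma unit_cube_upd:
  assumes "x \<in> unit_cube d" "i < d" "t \<in> {0..1}"
  shows "x(i := t) \<in> unit_cube d"
proof -
  have "t \<in> line_section (unit_cube d) i x"
    unfolding line_section_unit_cube[OF assms(1,2)] by (rule assms(3))
  then show ?thesis by (simp add: line_section_def)
qed

text \<open>Iterated partial derivatives in one direction are the derivatives of the function on the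
corresponding segment.\<close>

lemma section_derivative:
  assumes f: "cont_diff d (unit_cube d) r f" and "i < d" "k < r" and x: "x \<in> unit_cube d" and t: "t \<in> {0..1}"
  shows "((\<lambda>s. (partial (unit_cube d) i ^^ k) f (x(i := s))) has_real_derivative
    (partial (unit_cube d) i ^^ Suc k) f (x(i := t))) (at t within {0..1})"
proof -
  let ?F = "(partial (unit_cube d) i ^^ k) f" and ?y = "x(i := t)"
  have y: "?y \<in> unit_cube d"
    by (rule unit_cube_upd[OF x \<open>i < d\<close> t])
  have "cont_diff d (unit_cube d) (Suc (r - Suc k)) ?F"
    using cont_diff_iterated_partial[OF f \<open>i < d\<close>, of k] \<open>k < r\<close> by (simp add: Suc_diff_Suc)
  then have "has_partial (unit_cube d) i ?F ?y"
    using y \<open>i < d\<close> by simp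
  then have "((\<lambda>s. ?F (?y(i := s))) has_vector_derivative partial (unit_cube d) i ?F ?y) (at (?y i) within {0..1})"
    unfolding has_partial_def partial_def line_section_unit_cube[OF y \<open>i < d\<close>]
    by (simp only: vector_derivative_works)
  then show ?thesis
    by (simp add: has_real_derivative_iff_has_vector_derivative)
qed

lemma C_class_partial_bound:
  assumes f: "f \<in> C_class d D r" and "i < d" "x \<in> D" "k \<le> r"
  shows "\<bar>(partial D i ^^ k) f x\<bar> \<le> 1"
proof -
  define \<beta> where "\<beta> j = (if j = i then k else 0)" for j
  have "multi_partial D \<beta> j f = (if i < j then (partial D i ^^ k) f else f)" for j
    by (induction j) (auto simp: \<beta>_def less_Suc_eq)
  then have eq: "multi_partial D \<beta> d f = (partial D i ^^ k) f"
    using \<open>i < d\<close> by simp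
  have "(\<Sum>j<d. \<beta> j) \<le> r"
    using assms by (simp add: \<beta>_def)
  then have "(SUP x\<in>D. ereal \<bar>multi_partial D \<beta> d f x\<bar>) \<le> 1"
    using f by (simp add: C_class_def)
  then have "ereal \<bar>multi_partial D \<beta> d f x\<bar> \<le> 1"
    by (rule order_trans[rotated]) (rule SUP_upper[OF \<open>x \<in> D\<close>])
  then show ?thesis by (simp add: eq)
qed

lemma info_nonadaptive:
  assumes "k \<le> length gs"
  shows "info (\<lambda>ys. if length ys < length gs then gs ! length ys else y) k f = map f (take k gs)"
  using assms by (induction k) (auto simp: take_Suc_conv_app_nth)

text \<open>Nonadaptive sampling is a special case of adaptive sampling.\<close>

lemma algorithm_on_grid:
  assumes G: "finite G" "G \<subseteq> D" "D \<noteq> {}" and A: "\<And>f g. (\<And>x. x \<in> G \<Longrightarrow> f x = g x) \<Longrightarrow> A f = A g"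
  shows "A \<in> algorithms D (card G)"
proof -
  obtain gs where gs: "set gs = G" "distinct gs"
    using finite_distinct_list[OF G(1)] by blast
  then have len: "length gs = card G" by (metis distinct_card)
  obtain y where "y \<in> D" using G by blast
  define \<psi> where "\<psi> ys = (if length ys < length gs then gs ! length ys else y)" for ys :: "real list"
  define \<phi> where "\<phi> ys = A (\<lambda>x. the (map_of (zip gs ys) x))" for ys
  have "A f = \<phi> (info \<psi> (card G) f)" for f
  proof -
    have "info \<psi> (card G) f = map f gs"
      unfolding \<psi>_def using info_nonadaptive[of "card G" gs y f] len by simp
    then show ?thesis
      unfolding \<phi>_def using gs by (auto intro!: A simp: map_of_zip_map)
  qed
  moreover have "\<psi> ys \<in> D" for ys
    using gs G \<open>y \<in> D\<close> by (auto simp: \<psi>_def)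
  ultimately show ?thesis
    unfolding algorithms_def by blast
qed

text \<open>The algorithm integrates against the product of the quadrature measure. Its integrand is cut off
outside the grid of atoms, so that it depends on the sampled values only, whether or not the
function is measurable off the grid. The retraction onto the cube commutes with moving one
coordinate inside the unit interval, so the one-dimensional error bound holds along every line and
not only through points of the cube.\<close>

lemma minimal_error_upper:
  fixes p :: "real pmf"
  assumes "d \<ge> 1" and p: "finite (set_pmf p)" "set_pmf p \<subseteq> {0..1}"
    and quad: "quadrature_error_le r e p"
  shows "minimal_error d (unit_cube d) r (card (set_pmf p) ^ d) \<le> ereal (real d * e)"
proof -
  define \<nu> where "\<nu> = distr (measure_pmf p) borel (\<lambda>t. t)"
  define G where "G = ({..<d} \<rightarrow>\<^sub>E set_pmf p)"
  define A where "A f = (\<integral>x. indicator G x * f x \<partial>Pi\<^sub>M {..<d} (\<lambda>_. \<nu>))" for f :: "point \<Rightarrow> real"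
  interpret nu: prob_space \<nu>
    unfolding \<nu>_def by (rule measure_pmf.prob_space_distr) simp
  have sets_nu: "sets \<nu> = sets borel" by (simp add: \<nu>_def)
  have p_borel: "set_pmf p \<in> sets borel"
    using p by (intro borel_closed finite_imp_closed)
  have "finite G" and card_G: "card G = card (set_pmf p) ^ d"
    using p by (simp_all add: G_def card_PiE finite_PiE)
  have G_cube: "G \<subseteq> unit_cube d"
    unfolding G_def unit_cube_def by (rule PiE_mono) (use p in auto)
  have A_alg: "A \<in> algorithms (unit_cube d) (card G)"
  proof (rule algorithm_on_grid[OF \<open>finite G\<close> G_cube])
    show "unit_cube d \<noteq> {}" using accessible_unit_cube by (simp add: accessible_def)
    fix f g :: "point \<Rightarrow> real" assume "\<And>x. x \<in> G \<Longrightarrow> f x = g x"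
    then have "(\<lambda>x. indicator G x * f x) = (\<lambda>x. indicator G x * g x)"
      by (auto simp: indicator_def)
    then show "A f = A g" by (simp add: A_def)
  qed
  have AE_G: "AE x in Pi\<^sub>M {..<d} (\<lambda>_. \<nu>). x \<in> G"
  proof -
    have "AE t in \<nu>. t \<in> set_pmf p"
      unfolding \<nu>_def using p by (subst AE_distr_iff) (auto simp: AE_measure_pmf_iff p_borel)
    then have "AE x in Pi\<^sub>M {..<d} (\<lambda>_. \<nu>). x i \<in> set_pmf p" if "i < d" for i
      using that by (intro AE_PiM_component) (auto intro: nu.prob_space_axioms)
    then have "AE x in Pi\<^sub>M {..<d} (\<lambda>_. \<nu>). \<forall>i\<in>{..<d}. x i \<in> set_pmf p"
      by (intro AE_finite_allI) auto
    then show ?thesis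
      using AE_space by eventually_elim (auto simp: G_def space_PiM PiE_iff)
  qed
  have "\<bar>integral_on d (unit_cube d) f - A f\<bar> \<le> real d * e" if f: "f \<in> C_class d (unit_cube d) r" for f
  proof -
    define g where "g x = f (clamp_cube d x)" for x
    have cd: "cont_diff d (unit_cube d) r f" using f by (simp add: C_class_def)
    have cg: "continuous_on UNIV g"
      unfolding g_def by (rule continuous_on_clamp[OF cont_diff_continuous[OF cd]])
    have g_eq: "g x = f x" if "x \<in> unit_cube d" for x
      using that by (simp add: g_def clamp_cube_id)
    have g_bound: "\<bar>g x\<bar> \<le> 1" for x
      using C_class_partial_bound[OF f _ clamp_cube_in, of 0 0] \<open>d \<ge> 1\<close> by (simp add: g_def)
    have "\<bar>(\<integral>t. g (x(i := t)) \<partial>uniform01) - (\<integral>t. g (x(i := t)) \<partial>\<nu>)\<bar> \<le> e" if "i < d" for x i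
    proof -
      define y where "y = clamp_cube d x"
      have y: "y \<in> unit_cube d" by (simp add: y_def clamp_cube_in)
      define \<phi> where "\<phi> k t = (partial (unit_cube d) i ^^ k) f (y(i := t))" for k t
      have sec: "g (x(i := t)) = \<phi> 0 t" if "t \<in> {0..1}" for t
        using clamp_cube_upd[OF \<open>i < d\<close> that] by (simp add: g_def \<phi>_def y_def)
      have cs: "continuous_on UNIV (\<lambda>t. g (x(i := t)))"
        by (rule continuous_on_section[OF cg]) (intro continuous_intros)
      have "(\<integral>t. g (x(i := t)) \<partial>uniform01) = integral {0..1} (\<phi> 0)"
        unfolding integral_uniform01[OF cs] by (intro integral_cong sec)
      moreover have "(\<integral>t. g (x(i := t)) \<partial>\<nu>) = measure_pmf.expectation p (\<phi> 0)"
      proof -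
        have "(\<integral>t. g (x(i := t)) \<partial>\<nu>) = measure_pmf.expectation p (\<lambda>t. g (x(i := t)))"
          unfolding \<nu>_def using borel_measurable_continuous_onI[OF cs] by (intro integral_distr) auto
        also have "\<dots> = measure_pmf.expectation p (\<phi> 0)"
          by (intro integral_cong_AE) (use p sec in \<open>auto simp: AE_measure_pmf_iff\<close>)
        finally show ?thesis .
      qed
      moreover have "\<bar>integral {0..1} (\<phi> 0) - measure_pmf.expectation p (\<phi> 0)\<bar> \<le> e"
      proof (rule quad[unfolded quadrature_error_le_def, rule_format])
        show "(\<phi> k has_real_derivative \<phi> (Suc k) t) (at t within {0..1})" if "k < r" "t \<in> {0..1}" for k t
          unfolding \<phi>_def[abs_def] by (rule section_derivative[OF cd \<open>i < d\<close> that(1) y that(2)])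
        show "\<bar>\<phi> r t\<bar> \<le> 1" if "t \<in> {0..1}" for t
        proof -
          have "y(i := t) \<in> unit_cube d"
            by (rule unit_cube_upd[OF y \<open>i < d\<close> that])
          then show ?thesis
            unfolding \<phi>_def by (rule C_class_partial_bound[OF f \<open>i < d\<close>]) simp
        qed
      qed
      ultimately show ?thesis by simp
    qed
    then have "\<bar>(\<integral>x. g x \<partial>Pi\<^sub>M {..<d} (\<lambda>_. uniform01)) - (\<integral>x. g x \<partial>Pi\<^sub>M {..<d} (\<lambda>_. \<nu>))\<bar> \<le> real d * e"
      by (intro hybrid_product_integral[OF prob_space_uniform01 sets_uniform01 nu.prob_space_axioms sets_nu cg g_bound])
    moreover have "(\<integral>x. g x \<partial>Pi\<^sub>M {..<d} (\<lambda>_. uniform01)) = integral_on d (unit_cube d) f"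
    proof -
      have "(\<integral>x. g x \<partial>Pi\<^sub>M {..<d} (\<lambda>_. uniform01)) = integral_on d (unit_cube d) g"
        by (rule integral_on_unit_cube[symmetric])
           (simp add: rn_lborel_def borel_measurable_PiM_continuous[OF cg])
      also have "\<dots> = integral_on d (unit_cube d) f"
        unfolding integral_on_def set_lebesgue_integral_def
        by (intro Bochner_Integration.integral_cong refl) (auto simp: indicator_def g_eq)
      finally show ?thesis .
    qed
    moreover have "(\<integral>x. g x \<partial>Pi\<^sub>M {..<d} (\<lambda>_. \<nu>)) = A f"
    proof -
      have [measurable]: "g \<in> borel_measurable (Pi\<^sub>M {..<d} (\<lambda>_. \<nu>))"
        by (rule borel_measurable_PiM_continuous[OF cg sets_nu])
      have [measurable]: "G \<in> sets (Pi\<^sub>M {..<d} (\<lambda>_. \<nu>))"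
        unfolding G_def using p by (intro sets_PiM_I_finite) (auto simp: sets_nu p_borel)
      have "A f = (\<integral>x. indicator G x * g x \<partial>Pi\<^sub>M {..<d} (\<lambda>_. \<nu>))"
        unfolding A_def using G_cube
        by (intro Bochner_Integration.integral_cong refl) (auto simp: indicator_def g_eq)
      also have "\<dots> = (\<integral>x. g x \<partial>Pi\<^sub>M {..<d} (\<lambda>_. \<nu>))"
        by (intro integral_cong_AE) (use AE_G in auto)
      finally show ?thesis by simp
    qed
    ultimately show ?thesis by simp
  qed
  then have "worst_case_error d (unit_cube d) r A \<le> ereal (real d * e)"
    unfolding worst_case_error_def by (intro SUP_least) simp
  then show ?thesis
    unfolding minimal_error_def card_G[symmetric] using INF_lower2[OF A_alg] by blast
qed

text \<open>The number of cells is \<open>m\<close>, the least integer with \<open>2 d / m\<^sup>r \<le> \<epsilon>\<close>. For \<open>\<epsilon> < 1\<close> rounding up at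
most doubles it, because \<open>2 d / \<epsilon> \<ge> 1\<close>.\<close>

lemma info_complexity_upper:
  assumes "r \<ge> 1"
  obtains c :: real where "c > 0"
    and "\<And>d \<epsilon>. d \<ge> 1 \<Longrightarrow> 0 < \<epsilon> \<Longrightarrow> \<epsilon> < 1 \<Longrightarrow>
      ereal_of_enat (info_complexity \<epsilon> d (unit_cube d) r) \<le> ereal (c ^ d * (real d / \<epsilon>) powr (real d / real r))"
proof -
  from composite_quadrature_exists[OF assms] obtain N where "N \<ge> 1"
    and N: "\<forall>m\<ge>1. \<exists>p. finite (set_pmf p) \<and> card (set_pmf p) \<le> N * m \<and> set_pmf p \<subseteq> {0..1} \<and>
      quadrature_error_le r (2 / real m ^ r) p"
    by (elim exE conjE)
  define c where "c = real N * 2 * 2 powr (1 / real r)"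
  show ?thesis
  proof
    show "c > 0" using \<open>N \<ge> 1\<close> by (simp add: c_def)
    fix d :: nat and \<epsilon> :: real assume "d \<ge> 1" "0 < \<epsilon>" "\<epsilon> < 1"
    define b where "b = (2 * real d / \<epsilon>) powr (1 / real r)"
    have base: "2 * real d / \<epsilon> \<ge> 1"
      using \<open>d \<ge> 1\<close> \<open>0 < \<epsilon>\<close> \<open>\<epsilon> < 1\<close> by (simp add: le_divide_eq)
    then have "b \<ge> 1" by (simp add: b_def ge_one_powr_ge_zero)
    have b_pow: "b ^ r = 2 * real d / \<epsilon>"
    proof -
      have "b ^ r = b powr real r"
        using \<open>b \<ge> 1\<close> by (intro powr_realpow[symmetric]) simp
      also have "\<dots> = (2 * real d / \<epsilon>) powr 1"
        unfolding b_def powr_powr using assms by simp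
      also have "\<dots> = 2 * real d / \<epsilon>"
        by (rule powr_one_gt_zero_iff[THEN iffD2]) (use base in linarith)
      finally show ?thesis .
    qed
    define m where "m = nat \<lceil>b\<rceil>"
    have m: "b \<le> real m" "real m \<le> 2 * b" "m \<ge> 1"
      using \<open>b \<ge> 1\<close> by (auto simp: m_def) linarith+
    obtain p :: "real pmf" where p: "finite (set_pmf p)" "card (set_pmf p) \<le> N * m" "set_pmf p \<subseteq> {0..1}"
      and quad: "quadrature_error_le r (2 / real m ^ r) p"
      using N m(3) by blast
    have "minimal_error d (unit_cube d) r (card (set_pmf p) ^ d) \<le> ereal (real d * (2 / real m ^ r))"
      by (rule minimal_error_upper[OF \<open>d \<ge> 1\<close> p(1,3) quad])
    also have "\<dots> \<le> ereal \<epsilon>"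
    proof -
      have "2 * real d / \<epsilon> \<le> real m ^ r"
        unfolding b_pow[symmetric] using m \<open>b \<ge> 1\<close> by (intro power_mono) auto
      then have "real d * (2 / real m ^ r) \<le> \<epsilon>"
        using \<open>0 < \<epsilon>\<close> m(3) by (simp add: divide_le_eq mult.commute)
      then show ?thesis by simp
    qed
    finally have "info_complexity \<epsilon> d (unit_cube d) r \<le> enat (card (set_pmf p) ^ d)"
      unfolding info_complexity_def by (intro INF_lower) simp
    then have "ereal_of_enat (info_complexity \<epsilon> d (unit_cube d) r) \<le> ereal (real (card (set_pmf p) ^ d))"
      using ereal_of_enat_le_iff[of _ "enat (card (set_pmf p) ^ d)"] by simp
    also have "real (card (set_pmf p) ^ d) \<le> (c * (real d / \<epsilon>) powr (1 / real r)) ^ d"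
    proof -
      have "real (card (set_pmf p)) \<le> real (N * m)" using p(2) by (simp only: of_nat_le_iff)
      also have "\<dots> \<le> real N * (2 * b)" using m(2) by (simp add: mult_left_mono)
      also have "b = 2 powr (1 / real r) * (real d / \<epsilon>) powr (1 / real r)"
        unfolding b_def using \<open>0 < \<epsilon>\<close> by (subst powr_mult[symmetric]) auto
      finally have "real (card (set_pmf p)) \<le> c * (real d / \<epsilon>) powr (1 / real r)"
        by (simp add: c_def mult_ac)
      then show ?thesis by (simp add: power_mono)
    qed
    also have "(c * (real d / \<epsilon>) powr (1 / real r)) ^ d = c ^ d * (real d / \<epsilon>) powr (real d / real r)"
    proof -
      have "(real d / \<epsilon>) powr (real d / real r) = ((real d / \<epsilon>) powr (1 / real r)) powr real d"
        by (simp add: powr_powr)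
      also have "\<dots> = ((real d / \<epsilon>) powr (1 / real r)) ^ d"
        using \<open>d \<ge> 1\<close> \<open>0 < \<epsilon>\<close> by (intro powr_realpow) simp
      finally show ?thesis by (simp add: power_mult_distrib)
    qed
    finally show "ereal_of_enat (info_complexity \<epsilon> d (unit_cube d) r) \<le>
        ereal (c ^ d * (real d / \<epsilon>) powr (real d / real r))" by simp
  qed
qed

theorem theorem1:
  fixes r :: nat
  assumes "r \<ge> 1"
  shows "\<exists>c1 c2 :: real. c1 > 0 \<and> c2 > 0 \<and>
    (\<forall>d::nat. \<forall>\<epsilon>::real. d \<ge> 1 \<longrightarrow> 0 < \<epsilon> \<longrightarrow> \<epsilon> < 1/2 \<longrightarrow>
       ereal (c1 ^ d * (real d / \<epsilon>) powr (real d / real r))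
         \<le> ereal_of_enat (info_complexity \<epsilon> d (unit_cube d) r) \<and>
       ereal_of_enat (info_complexity \<epsilon> d (unit_cube d) r)
         \<le> ereal (c2 ^ d * (real d / \<epsilon>) powr (real d / real r))) \<and>
    (\<forall>d::nat. \<forall>D. \<forall>\<epsilon>::real. d \<ge> 1 \<longrightarrow> openin (rn_topology d) D \<longrightarrow>
       emeasure (rn_lborel d) D = 1 \<longrightarrow> 0 < \<epsilon> \<longrightarrow> \<epsilon> < 1/2 \<longrightarrow>
       ereal (c1 ^ d * (real d / \<epsilon>) powr (real d / real r))
         \<le> ereal_of_enat (info_complexity \<epsilon> d D r)) \<and>
    (\<forall>d::nat. \<forall>\<epsilon>::real. d \<ge> 1 \<longrightarrow> 0 < \<epsilon> \<longrightarrow> \<epsilon> < 1 \<longrightarrow>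
       ereal_of_enat (info_complexity \<epsilon> d (unit_cube d) r)
         \<le> ereal (c2 ^ d * (real d / \<epsilon>) powr (real d / real r)))"
proof -
  define c1 where "c1 = 1 / (4 * exp 1 * real (2 * r + 1) * 2 powr (1 / real r))"
  have "c1 > 0" by (simp add: c1_def add_pos_nonneg)
  obtain c2 :: real where "c2 > 0"
    and upper: "\<And>d \<epsilon>. d \<ge> 1 \<Longrightarrow> 0 < \<epsilon> \<Longrightarrow> \<epsilon> < 1 \<Longrightarrow>
      ereal_of_enat (info_complexity \<epsilon> d (unit_cube d) r) \<le> ereal (c2 ^ d * (real d / \<epsilon>) powr (real d / real r))"
    by (rule info_complexity_upper[OF assms]) blast
  have lower: "ereal (c1 ^ d * (real d / \<epsilon>) powr (real d / real r)) \<le> ereal_of_enat (info_complexity \<epsilon> d D r)"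
    if "d \<ge> 1" "0 < \<epsilon>" "\<epsilon> < 1/2" "accessible d D" "emeasure (rn_lborel d) D = 1" for d \<epsilon> D
    using that by (intro info_complexity_lower assms c1_def)
  have "accessible d D" if "openin (rn_topology d) D" "emeasure (rn_lborel d) D = 1" for d D
    using that by (intro accessible_open) auto
  then show ?thesis
    by - (rule exI[of _ c1], rule exI[of _ c2],
      use \<open>c1 > 0\<close> \<open>c2 > 0\<close> lower upper accessible_unit_cube emeasure_unit_cube in auto)
qed

end
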